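(* Let $N\in\mathbb{N}$, $n\in\{1,\dots,N\}$, $\ell\in\{1,\dots,n\}$ and let $Z=(z_{j,k})\in\mathbb{C}^{N\times n}$ satisfy $|z_{j,k}|\le 1$ for all $j\in\{1,\dots,N\}$, $k\in\{1,\dots,n\}$. Set $\widetilde z_k=\frac1N\sum_{j=1}^N z_{j,k}$, $a_{j,k}=z_{j,k}-\widetilde z_k$, and, for indeterminates $x=(x_1,\dots,x_n)$, $U_j(x)=\sum_{k=1}^n a_{j,k}x_k$. Put $$\alpha=\frac{1}{nN}\sum_{j=1}^N\sum_{k=1}^n|a_{j,k}|^2,\qquad \beta=\frac1n\sum_{k=1}^n|\widetilde z_k|^2,\qquad \gamma=\frac{n\alpha}{N}\min\Big\{n,\frac{1}{1-\beta}\Big\},$$ $$G_m(Z)=\frac{(N-m)!}{(n-m)!\,N!}\,\mathrm{Coeff}\Big(x_1\cdots x_n;\ \Big(\prod_{j=1}^N(1+U_j(x))\Big)\Big(\sum_{k=1}^n\widetilde z_kx_k\Big)^{n-m}\Big),\qquad m\in\{0,\dots,n\},$$ and $H_\ell(Z)=\sum_{m=0}^{\ell}G_m(Z)$. If $\gamma<1$, then $$\Big|\frac{(N-n)!}{N!}\mathrm{Per}(Z)-H_\ell(Z)\Big|\le(\ell+1)^{1/4}\,C_{\ell+1}\,\frac{\gamma^{(\ell+1)/2}}{(1-\gamma)^{3/4}}.$$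
   Context: For $r\in\mathbb{N}=\{1,2,\dots\}$, $C_r=\Big(\frac{\mathrm{e}^r\,r!}{r^{r+1/2}}\Big)^{1/2}$. $\mathrm{Coeff}(x_1\cdots x_n;\,p)$ denotes the coefficient of the monomial $x_1x_2\cdots x_n$ in the polynomial $p$ in the indeterminates $x_1,\dots,x_n$. The permanent of a rectangular matrix $Z=(z_{j,k})\in\mathbb{C}^{N\times n}$, $n\le N$, is $\mathrm{Per}(Z)=\sum\prod_{k=1}^n z_{j_k,k}$, the sum being over all $(j_1,\dots,j_n)\in\{1,\dots,N\}^n$ with pairwise distinct entries. Conventions: $0^0=1$; the zeroth power of a polynomial is $1$; $\frac{1}{1-\beta}$ is read as $+\infty$ if $\beta=1$ (in which case the minimum is $n$). *)

theory Defs
  imports Complex_Main "HOL-Library.Poly_Mapping" "HOL-Library.FuncSet"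
begin

text \<open>
  An \<open>N \<times> n\<close> matrix is a function \<open>Z :: nat \<Rightarrow> nat \<Rightarrow> complex\<close> of which only the entries \<open>Z j k\<close>
  with \<open>j \<in> {1..N}\<close> and \<open>k \<in> {1..n}\<close> are used.

  Polynomials in commuting indeterminates \<open>x\<^sub>k\<close> over the complex numbers form the ring of finitely
  supported maps from monomials (finitely supported exponent vectors, \<open>nat \<Rightarrow>\<^sub>0 nat\<close>) to
  coefficients. The indeterminates are indexed by all of \<open>nat\<close>, but only
  \<open>x\<^sub>1, \<dots>, x\<^sub>n\<close> ever occur.
\<close>

type_synonym cpoly = "(nat \<Rightarrow>\<^sub>0 nat) \<Rightarrow>\<^sub>0 complex"

definition const_poly :: "complex \<Rightarrow> cpoly" where
  "const_poly c = Poly_Mapping.single 0 c"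

definition indet :: "nat \<Rightarrow> cpoly" where
  "indet k = Poly_Mapping.single (Poly_Mapping.single k 1) 1"

definition coeff_x1_xn :: "nat \<Rightarrow> cpoly \<Rightarrow> complex" where
  "coeff_x1_xn n p = Poly_Mapping.lookup p (\<Sum>k=1..n. Poly_Mapping.single k 1)"

text \<open>
  The injective functions in the extensional function space are the tuples
  \<open>(j\<^sub>1, \<dots>, j\<^sub>n) \<in> {1..N}\<^sup>n\<close> with pairwise distinct entries.
\<close>

definition Per :: "nat \<Rightarrow> nat \<Rightarrow> (nat \<Rightarrow> nat \<Rightarrow> complex) \<Rightarrow> complex" where
  "Per N n Z = (\<Sum>j \<in> {j \<in> {1..n} \<rightarrow>\<^sub>E {1..N}. inj_on j {1..n}}. \<Prod>k=1..n. Z (j k) k)"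

definition C :: "nat \<Rightarrow> real" where
  "C r = (exp (real r) * fact r / real r powr (real r + 1/2)) powr (1/2)"

definition col_mean :: "nat \<Rightarrow> (nat \<Rightarrow> nat \<Rightarrow> complex) \<Rightarrow> nat \<Rightarrow> complex" where
  "col_mean N Z k = (1 / of_nat N) * (\<Sum>j=1..N. Z j k)"

definition centred :: "nat \<Rightarrow> (nat \<Rightarrow> nat \<Rightarrow> complex) \<Rightarrow> nat \<Rightarrow> nat \<Rightarrow> complex" where
  "centred N Z j k = Z j k - col_mean N Z k"

definition U :: "nat \<Rightarrow> nat \<Rightarrow> (nat \<Rightarrow> nat \<Rightarrow> complex) \<Rightarrow> nat \<Rightarrow> cpoly" where
  "U N n Z j = (\<Sum>k=1..n. const_poly (centred N Z j k) * indet k)"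

definition \<alpha> :: "nat \<Rightarrow> nat \<Rightarrow> (nat \<Rightarrow> nat \<Rightarrow> complex) \<Rightarrow> real" where
  "\<alpha> N n Z = (1 / (real n * real N)) * (\<Sum>j=1..N. \<Sum>k=1..n. (cmod (centred N Z j k))\<^sup>2)"

definition \<beta> :: "nat \<Rightarrow> nat \<Rightarrow> (nat \<Rightarrow> nat \<Rightarrow> complex) \<Rightarrow> real" where
  "\<beta> N n Z = (1 / real n) * (\<Sum>k=1..n. (cmod (col_mean N Z k))\<^sup>2)"

text \<open>
  The case distinction implements the convention that \<open>1 / (1 - \<beta>)\<close> is \<open>+\<infinity>\<close> for
  \<open>\<beta> = 1\<close>; in HOL this quotient would be \<open>0\<close>.
\<close>

definition \<gamma> :: "nat \<Rightarrow> nat \<Rightarrow> (nat \<Rightarrow> nat \<Rightarrow> complex) \<Rightarrow> real" where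
  "\<gamma> N n Z = (real n * \<alpha> N n Z / real N) *
     (if \<beta> N n Z = 1 then real n else min (real n) (1 / (1 - \<beta> N n Z)))"

definition G :: "nat \<Rightarrow> nat \<Rightarrow> nat \<Rightarrow> (nat \<Rightarrow> nat \<Rightarrow> complex) \<Rightarrow> complex" where
  "G N n m Z = (fact (N - m) / (fact (n - m) * fact N)) *
     coeff_x1_xn n
       ((\<Prod>j=1..N. 1 + U N n Z j) *
        (\<Sum>k=1..n. const_poly (col_mean N Z k) * indet k) ^ (n - m))"

definition H :: "nat \<Rightarrow> nat \<Rightarrow> nat \<Rightarrow> (nat \<Rightarrow> nat \<Rightarrow> complex) \<Rightarrow> complex" where
  "H N n l Z = (\<Sum>m=0..l. G N n m Z)"

end

theory Submission
  imports Defs "HOL-Analysis.Analysis"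
begin

text \<open>
  Split every column of \<open>Z\<close> into its mean \<open>w\<^sub>k\<close> and the deviation \<open>a\<^sub>j\<^sub>k\<close>, whose entries sum to
  zero. Expanding the permanent in the deviations shows that the normalised permanent is exactly
  the sum of the \<open>G\<^sub>m\<close> over \<open>m \<le> n\<close> (\<open>Per_eq_sum_G\<close>), and that \<open>G\<^sub>m\<close> is
  \<open>(N - m)! / N!\<close> times the sum, over all sets \<open>K\<close> of \<open>m\<close> columns, of the permanent of the deviations in
  \<open>K\<close> times the means of the remaining columns (\<open>G_eq_sum_perm\<close>). The error is therefore the tail
  from \<open>r = \<ell> + 1\<close> on, and the task is to bound \<open>G\<^sub>m\<close>.

  The permanent of an \<open>N \<times> m\<close> matrix is a symmetric multilinear form of its columns. By Banach's
  theorem (\<open>polarization_constant_one\<close>) its norm on the space of vectors with zero sum is attained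
  on equal columns, where it is \<open>m!\<close> times an elementary symmetric polynomial. That polynomial
  is a coefficient of the product of the \<open>s + t z x\<^sub>j\<close>, and as the \<open>x\<^sub>j\<close> sum to zero, the inequality between
  the geometric and the arithmetic mean bounds this product well on the unit circle
  (\<open>esym_centred_bound\<close>). This gives a Hadamard type bound for permanents of
  centred matrices (\<open>perm_centred_bound\<close>).

  Cauchy--Schwarz over the sets \<open>K\<close> and Maclaurin's inequality then yield
  (\<open>G_cmod_square_le\<close>), with \<open>t = n \<alpha> / N\<close> and \<open>D\<^sub>m = e\<^sup>m m! / m\<^sup>m\<close>,
  that \<open>|G\<^sub>m|\<^sup>2\<close> is at most \<open>(n choose m) \<beta>\<^bsup>n-m\<^esup> D\<^sub>m t\<^sup>m\<close>. Write \<open>\<gamma> = t \<mu>\<close> and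
  \<open>p\<^sub>m = (n choose m) \<beta>\<^bsup>n-m\<^esup> / \<mu>\<^sup>m\<close>, so that \<open>|G\<^sub>m|\<^sup>2 \<le> p\<^sub>m D\<^sub>m \<gamma>\<^sup>m\<close>. For either value of the
  minimum \<open>\<mu>\<close> the weights \<open>p\<^sub>m\<close> with \<open>m \<ge> 2\<close> sum to at most \<open>1\<close>
  (\<open>binomial_tail_weights_le_1\<close>), and a last application of Cauchy--Schwarz, now over \<open>m\<close>, bounds
  the square of the tail by the sum of \<open>D\<^sub>m \<gamma>\<^sup>m\<close>. The quotients of consecutive \<open>D\<^sub>m\<close> are dominated by
  those of the coefficients of \<open>(1 - \<gamma>)\<^bsup>-3/2\<^esup>\<close>, so that sum is at most
  \<open>D\<^sub>r \<gamma>\<^sup>r (1 - \<gamma>)\<^bsup>-3/2\<^esup>\<close> (\<open>sum_stirling_ratio_powers_le\<close>). Its square root is the bound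
  claimed, since \<open>D\<^sub>r\<close> is the square of \<open>r\<^bsup>1/4\<^esup> C\<^sub>r\<close>.
\<close>

section \<open>A Hermitian inner product on functions with finite support\<close>

text \<open>
  Vectors are functions of which only the entries in a finite set \<open>J\<close> matter. The dimension has to
  be a term, since it is the number of rows of the matrix, so the Hermitian geometry of
  \<open>\<complex>\<^sup>J\<close> is set up on functions instead of on a type of vectors.
\<close>

definition cinner_on :: "'j set \<Rightarrow> ('j \<Rightarrow> complex) \<Rightarrow> ('j \<Rightarrow> complex) \<Rightarrow> complex" where
  "cinner_on J x y = (\<Sum>j\<in>J. x j * cnj (y j))"

definition sqnorm_on :: "'j set \<Rightarrow> ('j \<Rightarrow> complex) \<Rightarrow> real" where
  "sqnorm_on J x = (\<Sum>j\<in>J. (cmod (x j))\<^sup>2)"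

text \<open>
  One closure property suffices, as scalar multiples come from \<open>a v = v + (a - 1) v\<close>. Vanishing off \<open>J\<close> makes \<open>sqnorm_on J\<close> definite on \<open>V\<close>.
\<close>

definition subspace_on :: "'j set \<Rightarrow> ('j \<Rightarrow> complex) set \<Rightarrow> bool" where
  "subspace_on J V \<longleftrightarrow> (\<forall>u\<in>V. \<forall>v\<in>V. \<forall>a. (\<lambda>j. u j + a * v j) \<in> V) \<and> (\<forall>v\<in>V. \<forall>j. j \<notin> J \<longrightarrow> v j = 0)"

definition multilinear_on :: "'k set \<Rightarrow> (('k \<Rightarrow> 'j \<Rightarrow> complex) \<Rightarrow> complex) \<Rightarrow> bool" where
  "multilinear_on K L \<longleftrightarrow> (\<forall>X. \<forall>k\<in>K. \<forall>u v a.
     L (X(k := \<lambda>j. u j + a * v j)) = L (X(k := u)) + a * L (X(k := v)))"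

definition symmetric_on :: "'k set \<Rightarrow> (('k \<Rightarrow> 'v) \<Rightarrow> 'r) \<Rightarrow> bool" where
  "symmetric_on K L \<longleftrightarrow> (\<forall>X. \<forall>i\<in>K. \<forall>k\<in>K. i \<noteq> k \<longrightarrow>
     (\<forall>u v. L (X(i := u, k := v)) = L (X(i := v, k := u))))"

lemma subspace_onD:
  assumes "subspace_on J V" "u \<in> V" "v \<in> V"
  shows "(\<lambda>j. u j + a * v j) \<in> V"
  using assms by (auto simp: subspace_on_def)

lemma subspace_on_scale:
  assumes "subspace_on J V" "v \<in> V"
  shows "(\<lambda>j. a * v j) \<in> V"
proof -
  have "(\<lambda>j. v j + (a - 1) * v j) \<in> V" using assms by (intro subspace_onD)
  then show ?thesis by (simp add: algebra_simps)
qed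

lemma sqnorm_on_nonneg: "sqnorm_on J x \<ge> 0"
  by (simp add: sqnorm_on_def sum_nonneg)

lemma sqnorm_on_scale: "sqnorm_on J (\<lambda>j. a * x j) = (cmod a)\<^sup>2 * sqnorm_on J x"
  by (simp add: sqnorm_on_def norm_mult power_mult_distrib sum_distrib_left)

lemma sqnorm_on_eq_0:
  assumes "finite J" "subspace_on J V" "v \<in> V" "sqnorm_on J v = 0"
  shows "v = (\<lambda>_. 0)"
proof
  fix j
  show "v j = 0"
  proof (cases "j \<in> J")
    case True
    then show ?thesis
      using assms(1,4) by (auto simp: sqnorm_on_def sum_nonneg_eq_0_iff)
  next
    case False
    then show ?thesis using assms(2,3) by (auto simp: subspace_on_def)
  qed
qed

lemma of_real_cmod_square: "(complex_of_real (cmod z))\<^sup>2 = z * cnj z"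
  using complex_norm_square[of z] by simp

lemma cinner_on_self: "cinner_on J x x = of_real (sqnorm_on J x)"
  by (simp add: cinner_on_def sqnorm_on_def of_real_cmod_square)

lemma cinner_on_commute: "cinner_on J y x = cnj (cinner_on J x y)"
  by (simp add: cinner_on_def mult.commute)

lemma cinner_on_add_left:
  "cinner_on J (\<lambda>j. u j + a * v j) w = cinner_on J u w + a * cinner_on J v w"
  by (simp add: cinner_on_def algebra_simps sum.distrib sum_distrib_left)

lemma sqnorm_on_add:
  "sqnorm_on J (\<lambda>j. x j + a * y j) =
   sqnorm_on J x + 2 * Re (cnj a * cinner_on J x y) + (cmod a)\<^sup>2 * sqnorm_on J y"
proof -
  have "complex_of_real (sqnorm_on J (\<lambda>j. x j + a * y j)) =
        cinner_on J (\<lambda>j. x j + a * y j) (\<lambda>j. x j + a * y j)"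
    by (simp add: cinner_on_self)
  also have "\<dots> = of_real (sqnorm_on J x) + (cnj a * cinner_on J x y + cnj (cnj a * cinner_on J x y))
       + of_real ((cmod a)\<^sup>2 * sqnorm_on J y)"
  proof -
    have 1: "cinner_on J x (\<lambda>j. x j + a * y j) = cinner_on J x x + cnj a * cinner_on J x y"
      by (simp add: cinner_on_def algebra_simps sum.distrib sum_distrib_left)
    have 2: "cinner_on J y (\<lambda>j. x j + a * y j) = cinner_on J y x + cnj a * cinner_on J y y"
      by (simp add: cinner_on_def algebra_simps sum.distrib sum_distrib_left)
    have 3: "complex_of_real ((cmod a)\<^sup>2) = a * cnj a" by (rule complex_norm_square)
    show ?thesis
      unfolding cinner_on_add_left 1 2 of_real_mult 3
      by (simp add: cinner_on_self cinner_on_commute[of J y x] algebra_simps)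
  qed
  also have "\<dots> = of_real (sqnorm_on J x + 2 * Re (cnj a * cinner_on J x y) + (cmod a)\<^sup>2 * sqnorm_on J y)"
    by (subst complex_add_cnj) simp
  finally show ?thesis by (simp only: of_real_eq_iff)
qed

section \<open>Polarization of symmetric multilinear forms\<close>

text \<open>
  Equality in the Riesz representation: a linear functional that attains its norm at a unit vector
  \<open>y\<close> is a multiple of the inner product with \<open>y\<close>. If it did not vanish at some \<open>w'\<close> orthogonal to
  \<open>y\<close>, moving from \<open>y\<close> a little in a suitable direction \<open>t w'\<close> would raise its value to first order but the
  norm of the vector only to second order.
\<close>

lemma norming_functional_eq_inner:
  fixes \<phi> :: "('j \<Rightarrow> complex) \<Rightarrow> complex"
  assumes V: "subspace_on J V"
    and lin: "\<And>u v a. u \<in> V \<Longrightarrow> v \<in> V \<Longrightarrow> \<phi> (\<lambda>j. u j + a * v j) = \<phi> u + a * \<phi> v"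
    and bound: "\<And>v. v \<in> V \<Longrightarrow> (cmod (\<phi> v))\<^sup>2 \<le> s\<^sup>2 * sqnorm_on J v"
    and y: "y \<in> V" "sqnorm_on J y = 1" "cmod (\<phi> y) = s"
    and w: "w \<in> V"
  shows "\<phi> w = \<phi> y * cinner_on J w y"
proof -
  define w' where "w' = (\<lambda>j. w j + (- cinner_on J w y) * y j)"
  define d c q where "d = \<phi> w'" and "c = \<phi> y" and "q = sqnorm_on J w'"
  have w'V: "w' \<in> V" unfolding w'_def using V w y(1) by (intro subspace_onD)
  have orth: "cinner_on J w' y = 0"
    unfolding w'_def cinner_on_add_left using y(2) by (simp add: cinner_on_self)
  have orth': "cinner_on J y w' = 0" using orth cinner_on_commute[of J y w'] by simp
  have q0: "q \<ge> 0" by (simp add: q_def sqnorm_on_nonneg)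
  have "d = 0"
  proof (rule ccontr)
    assume d0: "d \<noteq> 0"
    then have s0: "s \<noteq> 0"
      using bound[OF w'V] by (auto simp: d_def)
    \<comment> \<open>The bound along \<open>y + t w'\<close> forces \<open>2 \<le> e s\<^sup>2 q\<close>, so any \<open>e\<close> with \<open>e s\<^sup>2 q < 2\<close> refutes it.\<close>
    define e where "e = 1 / (s\<^sup>2 * q + 1)"
    have e0: "e > 0" unfolding e_def using q0 by (intro divide_pos_pos add_nonneg_pos) auto
    define t where "t = complex_of_real e * c * cnj d"
    define D where "D = (cmod d)\<^sup>2"
    have D0: "D > 0" using d0 by (simp add: D_def)
    have mem: "(\<lambda>j. y j + t * w' j) \<in> V" using V y(1) w'V by (intro subspace_onD)
    have "\<phi> (\<lambda>j. y j + t * w' j) = c + t * d" using lin[OF y(1) w'V] by (simp add: c_def d_def)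
    also have "\<dots> = c * of_real (1 + e * D)"
      by (simp add: t_def D_def of_real_cmod_square algebra_simps)
    finally have "(cmod (\<phi> (\<lambda>j. y j + t * w' j)))\<^sup>2 = s\<^sup>2 * (1 + e * D)\<^sup>2"
      using y(3) by (simp only: norm_mult norm_of_real power_mult_distrib power2_abs c_def)
    moreover have "sqnorm_on J (\<lambda>j. y j + t * w' j) = 1 + (cmod t)\<^sup>2 * q"
      unfolding sqnorm_on_add using y(2) orth' by (simp add: q_def)
    moreover have "(cmod t)\<^sup>2 = e\<^sup>2 * s\<^sup>2 * D"
      using y(3) by (simp add: t_def norm_mult power_mult_distrib c_def D_def)
    ultimately have "s\<^sup>2 * (1 + e * D)\<^sup>2 \<le> s\<^sup>2 * (1 + e\<^sup>2 * s\<^sup>2 * D * q)"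
      using bound[OF mem] by simp
    then have "(1 + e * D)\<^sup>2 \<le> 1 + e\<^sup>2 * s\<^sup>2 * D * q"
      using s0 by (simp add: mult_le_cancel_left)
    then have "(e * D) * (2 + e * D) \<le> (e * D) * (e * (s\<^sup>2 * q))"
      by (simp add: power2_eq_square algebra_simps)
    then have "2 + e * D \<le> e * (s\<^sup>2 * q)" using e0 D0 by simp
    also have "\<dots> \<le> 1" unfolding e_def using q0 by (simp add: divide_simps add_nonneg_pos)
    finally show False using mult_pos_pos[OF e0 D0] by simp
  qed
  moreover have "d = \<phi> w - cinner_on J w y * c"
    unfolding d_def w'_def c_def lin[OF w y(1)] by simp
  ultimately show ?thesis by (simp add: c_def)
qed

text \<open>
  If a symmetric bilinear form attains its norm at a pair of unit vectors \<open>(x, y)\<close>, it also attains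
  it on the diagonal, at the normalisation of \<open>x + y\<close>. Indeed both partial functionals attain their
  norm, so \<open>B w y = B x y \<langle>w, x\<rangle>\<close> and \<open>B x w = B x y \<langle>w, y\<rangle>\<close>; expanding \<open>B (x + y) (x + y)\<close> gives
  \<open>B x y\<close> times \<open>\<parallel>x + y\<parallel>\<^sup>2\<close>. Applied to two slots of a multilinear form, this lets two
  arguments of a maximiser be replaced by one repeated vector.
\<close>

lemma bilinear_maximiser_diagonal:
  fixes B :: "('j \<Rightarrow> complex) \<Rightarrow> ('j \<Rightarrow> complex) \<Rightarrow> complex"
  assumes V: "subspace_on J V" and fin: "finite J"
    and lin: "\<And>u v a w. B (\<lambda>j. u j + a * v j) w = B u w + a * B v w"
    and sym: "\<And>u v. B u v = B v u"
    and bound: "\<And>u v. u \<in> V \<Longrightarrow> v \<in> V \<Longrightarrow> sqnorm_on J u = 1 \<Longrightarrow> sqnorm_on J v = 1 \<Longrightarrow> cmod (B u v) \<le> s"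
    and x: "x \<in> V" "sqnorm_on J x = 1" and y: "y \<in> V" "sqnorm_on J y = 1"
    and max: "cmod (B x y) = s"
  shows "B (\<lambda>j. x j + y j) (\<lambda>j. x j + y j) = B x y * of_real (sqnorm_on J (\<lambda>j. x j + y j))"
proof -
  have scale: "B (\<lambda>j. a * u j) w = a * B u w" for a u w
    using lin[of u "a - 1" u w] by (simp add: algebra_simps)
  have s0: "s \<ge> 0" using max by auto
  have bd: "(cmod (B v z))\<^sup>2 \<le> s\<^sup>2 * sqnorm_on J v"
    if "v \<in> V" "z \<in> V" "sqnorm_on J z = 1" for v z
  proof (cases "sqnorm_on J v = 0")
    case True
    have "v = (\<lambda>j. 0 * v j)" using sqnorm_on_eq_0[OF fin V that(1) True] by simp
    then have "B v z = 0" using scale[of 0 v z] by simp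
    then show ?thesis using True by simp
  next
    case False
    define a where "a = sqrt (sqnorm_on J v)"
    have a: "a > 0" "a\<^sup>2 = sqnorm_on J v"
      using False sqnorm_on_nonneg[of J v] by (auto simp: a_def)
    have "sqnorm_on J (\<lambda>j. of_real (1 / a) * v j) = 1"
      unfolding sqnorm_on_scale norm_of_real power2_abs using a by (simp add: power_divide False)
    then have "cmod (B (\<lambda>j. of_real (1 / a) * v j) z) \<le> s"
      using that V by (intro bound subspace_on_scale) auto
    then have "cmod (B v z) \<le> s * a"
      unfolding scale norm_mult norm_of_real using a by (simp add: field_simps)
    then have "(cmod (B v z))\<^sup>2 \<le> (s * a)\<^sup>2" by (intro power_mono) auto
    then show ?thesis using a by (simp add: power_mult_distrib)
  qed
  define c where "c = B x y"
  have 1: "B w y = B x y * cinner_on J w x" if "w \<in> V" for w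
    by (rule norming_functional_eq_inner[OF V _ _ x _ that, where s = s])
       (use lin bd y max in auto)
  have 2: "B w x = B y x * cinner_on J w y" if "w \<in> V" for w
    by (rule norming_functional_eq_inner[OF V _ _ y _ that, where s = s])
       (use lin bd x max sym in auto)
  have "B (\<lambda>j. x j + y j) w = B x w + B y w" for w using lin[of x 1 y w] by simp
  then have "B (\<lambda>j. x j + y j) (\<lambda>j. x j + y j) = B x x + 2 * B x y + B y y"
    by (metis (no_types, lifting) sym add.assoc mult_2)
  also have "\<dots> = c * (cinner_on J x y + 2 + cinner_on J y x)"
    using 1[OF y(1)] 2[OF x(1)] by (simp add: c_def sym[of y x] algebra_simps)
  also have "cinner_on J x y + 2 + cinner_on J y x = of_real (2 + 2 * Re (cinner_on J x y))"
    using complex_add_cnj[of "cinner_on J x y"] cinner_on_commute[of J y x] by (simp add: algebra_simps)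
  also have "2 + 2 * Re (cinner_on J x y) = sqnorm_on J (\<lambda>j. x j + y j)"
    using sqnorm_on_add[of J x 1 y] x y by simp
  finally show ?thesis by (simp add: c_def)
qed

lemma continuous_on_entry:
  "continuous_on A (\<lambda>X::'k \<Rightarrow> 'j \<Rightarrow> complex. X k j)"
  by (rule continuous_on_product_then_coordinatewise[OF continuous_on_product_then_coordinatewise[OF continuous_on_id]])

lemma continuous_on_sqnorm_slot:
  "continuous_on A (\<lambda>X::'k \<Rightarrow> 'j \<Rightarrow> complex. sqnorm_on J (X k))"
  unfolding sqnorm_on_def by (intro continuous_on_sum continuous_on_power continuous_on_norm continuous_on_entry)

text \<open>
  Tychonoff's theorem for the product of discs. The slots outside \<open>K\<close> are also confined to the
  unit disc, since otherwise the set of tuples would not be compact.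
\<close>

lemma compact_unit_tuples:
  fixes V :: "('j \<Rightarrow> complex) set"
  assumes "closed V"
  shows "compact {X :: 'k \<Rightarrow> 'j \<Rightarrow> complex.
    (\<forall>k j. X k j \<in> cball 0 1) \<and> (\<forall>k\<in>K. X k \<in> V \<and> sqnorm_on J (X k) = 1)}"
proof -
  have "compactin (product_topology (\<lambda>i. euclidean) UNIV) (PiE UNIV (\<lambda>j::'j. cball (0::complex) 1))"
    by (subst compactin_PiE) auto
  then have "compact (PiE UNIV (\<lambda>j::'j. cball (0::complex) 1))"
    by (simp add: euclidean_product_topology)
  then have "compactin (product_topology (\<lambda>i. euclidean) UNIV)
     (PiE UNIV (\<lambda>k::'k. PiE UNIV (\<lambda>j::'j. cball (0::complex) 1)))"
    by (subst compactin_PiE) auto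
  then have "compact (PiE UNIV (\<lambda>k::'k. PiE UNIV (\<lambda>j::'j. cball (0::complex) 1)))"
    by (simp add: euclidean_product_topology)
  moreover have "closed (\<Inter>k\<in>K. (\<lambda>X::'k \<Rightarrow> 'j \<Rightarrow> complex. X k) -` V \<inter> {X. sqnorm_on J (X k) = 1})"
  proof (intro closed_INT ballI closed_Int)
    fix k
    show "closed ((\<lambda>X::'k \<Rightarrow> 'j \<Rightarrow> complex. X k) -` V)"
      by (rule closed_vimage[OF assms continuous_on_product_coordinates])
    show "closed {X::'k \<Rightarrow> 'j \<Rightarrow> complex. sqnorm_on J (X k) = 1}"
      by (rule closed_Collect_eq[OF continuous_on_sqnorm_slot continuous_on_const])
  qed
  ultimately have "compact (PiE UNIV (\<lambda>k::'k. PiE UNIV (\<lambda>j::'j. cball (0::complex) 1)) \<inter>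
     (\<Inter>k\<in>K. (\<lambda>X::'k \<Rightarrow> 'j \<Rightarrow> complex. X k) -` V \<inter> {X. sqnorm_on J (X k) = 1}))"
    by (rule compact_Int_closed)
  also have "\<dots> = {X. (\<forall>k j. X k j \<in> cball 0 1) \<and> (\<forall>k\<in>K. X k \<in> V \<and> sqnorm_on J (X k) = 1)}"
    by (auto simp: PiE_def Pi_def)
  finally show ?thesis .
qed

lemma multilinear_on_scale_slot:
  assumes "multilinear_on K L" "k \<in> K"
  shows "L (X(k := \<lambda>j. a * u j)) = a * L (X(k := u))"
proof -
  have "L (X(k := \<lambda>j. u j + (a - 1) * u j)) = L (X(k := u)) + (a - 1) * L (X(k := u))"
    using assms by (auto simp: multilinear_on_def)
  then show ?thesis by (simp add: algebra_simps)
qed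

lemma multilinear_on_scale:
  assumes "multilinear_on K L" "finite T" "T \<subseteq> K"
  shows "L (\<lambda>k. if k \<in> T then (\<lambda>j. c k * X k j) else X k) = (\<Prod>k\<in>T. c k) * L X"
  using assms(2,3)
proof (induction T)
  case empty
  then show ?case by simp
next
  case (insert k T)
  let ?Y = "\<lambda>i. if i \<in> T then (\<lambda>j. c i * X i j) else X i"
  have "(\<lambda>i. if i \<in> insert k T then (\<lambda>j. c i * X i j) else X i) = ?Y(k := \<lambda>j. c k * X k j)"
    using insert.hyps by auto
  then have "L (\<lambda>i. if i \<in> insert k T then (\<lambda>j. c i * X i j) else X i) = c k * L (?Y(k := X k))"
    using multilinear_on_scale_slot[OF assms(1)] insert.prems by simp
  also have "?Y(k := X k) = ?Y" using insert.hyps by auto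
  finally show ?case using insert by simp
qed

text \<open>
  The maximum of \<open>|L|\<close> over tuples of unit vectors is attained with all arguments equal. Among the
  maximisers, which form a compact set, one is chosen that maximises the sum of
  \<open>Re \<langle>Y k, e\<rangle>\<close> for a fixed vector \<open>e\<close>. Two distinct arguments \<open>x\<close> and \<open>y\<close> of it could both be
  replaced by \<open>u = (x + y) / \<parallel>x + y\<parallel>\<close> (by \<open>bilinear_maximiser_diagonal\<close>), and since
  \<open>\<parallel>x + y\<parallel> < 2\<close> the contribution \<open>2 Re \<langle>u, e\<rangle>\<close> would exceed \<open>Re \<langle>x + y, e\<rangle>\<close> whenever the latter is
  positive. Changes of sign of single arguments ensure that positivity.
\<close>

lemma polarization_unit:
  fixes L :: "('k \<Rightarrow> 'j \<Rightarrow> complex) \<Rightarrow> complex"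
  assumes fin: "finite J" "finite K" and K: "K \<noteq> {}"
    and V: "subspace_on J V" "closed V"
    and ml: "multilinear_on K L" and sym: "symmetric_on K L"
    and cont: "continuous_on UNIV L"
    and cong: "\<And>X Y. (\<And>k. k \<in> K \<Longrightarrow> X k = Y k) \<Longrightarrow> L X = L Y"
    and diag: "\<And>x. x \<in> V \<Longrightarrow> sqnorm_on J x = 1 \<Longrightarrow> cmod (L (\<lambda>_. x)) \<le> M"
    and X: "\<And>k. k \<in> K \<Longrightarrow> X k \<in> V" "\<And>k. k \<in> K \<Longrightarrow> sqnorm_on J (X k) = 1"
  shows "cmod (L X) \<le> M"
proof -
  define \<Omega> :: "('k \<Rightarrow> 'j \<Rightarrow> complex) set" where
    "\<Omega> = {X. (\<forall>k j. X k j \<in> cball 0 1) \<and> (\<forall>k\<in>K. X k \<in> V \<and> sqnorm_on J (X k) = 1)}"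
  have comp: "compact \<Omega>" unfolding \<Omega>_def by (rule compact_unit_tuples[OF V(2)])
  have unit_le: "cmod (v j) \<le> 1" if "v \<in> V" "sqnorm_on J v = 1" for v j
  proof (cases "j \<in> J")
    case True
    have "(cmod (v j))\<^sup>2 \<le> sqnorm_on J v"
      unfolding sqnorm_on_def using True fin by (intro member_le_sum) auto
    then show ?thesis using that power2_le_imp_le[of "cmod (v j)" 1] by simp
  next
    case False
    then show ?thesis using that V by (auto simp: subspace_on_def)
  qed
  have upd: "Y(k := v) \<in> \<Omega>" if "Y \<in> \<Omega>" "v \<in> V" "sqnorm_on J v = 1" for Y k v
    using that unit_le[OF that(2,3)] by (auto simp: \<Omega>_def)
  \<comment> \<open>The slots outside \<open>K\<close> are arbitrary, so they are cleared to reach the compact set.\<close>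
  define X' where "X' = (\<lambda>k. if k \<in> K then X k else (\<lambda>_. 0))"
  have X': "X' \<in> \<Omega>" using X unit_le by (auto simp: \<Omega>_def X'_def)
  have LX': "L X' = L X" by (rule cong) (simp add: X'_def)
  obtain X0 where X0: "X0 \<in> \<Omega>" "\<And>Y. Y \<in> \<Omega> \<Longrightarrow> cmod (L Y) \<le> cmod (L X0)"
  proof -
    have "\<exists>x\<in>\<Omega>. \<forall>y\<in>\<Omega>. cmod (L y) \<le> cmod (L x)"
      using comp X' by (intro continuous_attains_sup continuous_on_norm continuous_on_subset[OF cont]) auto
    then show ?thesis using that by blast
  qed
  define s where "s = cmod (L X0)"
  obtain k0 where k0: "k0 \<in> K" using K by auto
  define e where "e = X0 k0"
  define P :: "('k \<Rightarrow> 'j \<Rightarrow> complex) \<Rightarrow> real" where "P = (\<lambda>Y. \<Sum>k\<in>K. Re (cinner_on J (Y k) e))"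
  define \<Omega>' where "\<Omega>' = {Y \<in> \<Omega>. cmod (L Y) = s}"
  have contP: "continuous_on UNIV P"
    unfolding P_def cinner_on_def
    by (intro continuous_on_sum continuous_on_Re continuous_on_mult continuous_on_const continuous_on_entry)
  have comp': "compact \<Omega>'"
  proof -
    have "closed {Y. cmod (L Y) = s}" by (intro closed_Collect_eq continuous_on_norm continuous_on_const cont)
    then have "compact (\<Omega> \<inter> {Y. cmod (L Y) = s})" by (rule compact_Int_closed[OF comp])
    moreover have "\<Omega> \<inter> {Y. cmod (L Y) = s} = \<Omega>'" by (auto simp: \<Omega>'_def)
    ultimately show ?thesis by simp
  qed
  \<comment> \<open>Signs make all the inner products with \<open>e\<close> nonnegative; that of \<open>e\<close> with itself is already \<open>1\<close>.\<close>
  define \<sigma> :: "'k \<Rightarrow> complex" where "\<sigma> k = (if Re (cinner_on J (X0 k) e) < 0 then -1 else 1)" for k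
  define X1 where "X1 = (\<lambda>k. if k \<in> K then (\<lambda>j. \<sigma> k * X0 k j) else X0 k)"
  have cm\<sigma>: "cmod (\<sigma> k) = 1" for k by (simp add: \<sigma>_def)
  have X1: "X1 \<in> \<Omega>'"
  proof -
    have "L X1 = (\<Prod>k\<in>K. \<sigma> k) * L X0"
      unfolding X1_def by (rule multilinear_on_scale[OF ml fin(2)]) simp
    then have "cmod (L X1) = s" by (simp add: norm_mult cm\<sigma> s_def prod_norm[symmetric])
    moreover have "X1 \<in> \<Omega>"
      using X0(1) subspace_on_scale[OF V(1)]
      by (simp add: \<Omega>_def X1_def sqnorm_on_scale norm_mult cm\<sigma>)
    ultimately show ?thesis by (simp add: \<Omega>'_def)
  qed
  have PX1: "P X1 \<ge> 1"
  proof -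
    have nn: "Re (cinner_on J (X1 k) e) \<ge> 0" if "k \<in> K" for k
    proof -
      have "cinner_on J (X1 k) e = \<sigma> k * cinner_on J (X0 k) e"
        using that by (simp add: X1_def cinner_on_def sum_distrib_left mult.assoc)
      then show ?thesis by (simp add: \<sigma>_def)
    qed
    have "cinner_on J e e = 1" using X0(1) k0 by (simp add: cinner_on_self e_def \<Omega>_def)
    then have "cinner_on J (X1 k0) e = 1"
      using k0 by (simp add: X1_def e_def \<sigma>_def)
    moreover have "Re (cinner_on J (X1 k0) e) \<le> P X1"
      unfolding P_def using k0 fin nn by (intro member_le_sum) auto
    ultimately show ?thesis by simp
  qed
  obtain Y where Y: "Y \<in> \<Omega>'" "\<And>Z. Z \<in> \<Omega>' \<Longrightarrow> P Z \<le> P Y"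
  proof -
    have "\<exists>x\<in>\<Omega>'. \<forall>y\<in>\<Omega>'. P y \<le> P x"
      using comp' X1 by (intro continuous_attains_sup continuous_on_subset[OF contP]) auto
    then show ?thesis using that by blast
  qed
  have Y\<Omega>: "Y \<in> \<Omega>" and LY: "cmod (L Y) = s" using Y(1) by (auto simp: \<Omega>'_def)
  have YV: "Y k \<in> V" "sqnorm_on J (Y k) = 1" if "k \<in> K" for k using Y\<Omega> that by (auto simp: \<Omega>_def)
  \<comment> \<open>Otherwise a change of sign in this slot would give a maximiser of \<open>|L|\<close> with a larger sum.\<close>
  have nn: "Re (cinner_on J (Y k) e) \<ge> 0" if k: "k \<in> K" for k
  proof -
    define Z where "Z = Y(k := \<lambda>j. (-1) * Y k j)"
    have "L Z = - L Y"
      unfolding Z_def using multilinear_on_scale_slot[OF ml k, of Y "-1" "Y k"] by simp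
    moreover have "Z \<in> \<Omega>"
      unfolding Z_def
      by (rule upd[OF Y\<Omega> subspace_on_scale[OF V(1) YV(1)[OF k]]])
         (use YV(2)[OF k] sqnorm_on_scale[of J "-1" "Y k"] in simp)
    ultimately have "P Z \<le> P Y" using LY by (intro Y(2)) (simp add: \<Omega>'_def)
    moreover have "P Z = P Y - 2 * Re (cinner_on J (Y k) e)"
    proof -
      have "cinner_on J (Z k) e = - cinner_on J (Y k) e"
        by (simp add: Z_def cinner_on_def sum_negf)
      moreover have "(\<Sum>i\<in>K-{k}. Re (cinner_on J (Z i) e)) = (\<Sum>i\<in>K-{k}. Re (cinner_on J (Y i) e))"
        by (intro sum.cong) (auto simp: Z_def)
      ultimately show ?thesis
        unfolding P_def by (simp add: sum.remove[OF fin(2) k])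
    qed
    ultimately show ?thesis by simp
  qed
  have "P Y \<ge> 1" using Y(2)[OF X1] PX1 by simp
  then obtain i where i: "i \<in> K" "Re (cinner_on J (Y i) e) > 0"
  proof -
    have "\<exists>i\<in>K. Re (cinner_on J (Y i) e) > 0"
    proof (rule ccontr)
      assume "\<not> ?thesis"
      then have "P Y \<le> 0" unfolding P_def by (intro sum_nonpos) auto
      then show False using \<open>P Y \<ge> 1\<close> by simp
    qed
    then show ?thesis using that by blast
  qed
  have all_eq: "Y k = Y i" if k: "k \<in> K" for k
  proof (rule ccontr)
    assume ne: "Y k \<noteq> Y i"
    then have ki: "k \<noteq> i" by auto
    define B where "B = (\<lambda>u v. L (Y(i := u, k := v)))"
    define w where "w = (\<lambda>j. Y i j + Y k j)"
    define q where "q = sqnorm_on J w"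
    have Bxy: "B (Y i) (Y k) = L Y" by (simp add: B_def)
    have lin: "B (\<lambda>j. u j + a * v j) z = B u z + a * B v z" for u v a z
    proof -
      have "L ((Y(k := z))(i := \<lambda>j. u j + a * v j)) = L ((Y(k := z))(i := u)) + a * L ((Y(k := z))(i := v))"
        using ml i(1) unfolding multilinear_on_def by blast
      then show ?thesis unfolding B_def using ki by (simp add: fun_upd_twist)
    qed
    have symB: "B u v = B v u" for u v
      unfolding B_def using sym[unfolded symmetric_on_def, rule_format, of i k Y u v] i(1) k ki by simp
    have boundB: "cmod (B u v) \<le> s"
      if "u \<in> V" "v \<in> V" "sqnorm_on J u = 1" "sqnorm_on J v = 1" for u v
      unfolding B_def s_def using that by (intro X0(2) upd Y\<Omega>)
    have w: "B w w = L Y * of_real q"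
      unfolding w_def q_def Bxy[symmetric]
      by (rule bilinear_maximiser_diagonal[OF V(1) fin(1) lin symB, where s = s])
         (use YV[OF k] YV[OF i(1)] LY Bxy boundB in auto)
    have wV: "w \<in> V" using subspace_onD[OF V(1) YV(1)[OF i(1)] YV(1)[OF k], of 1] by (simp add: w_def)
    have ip: "cinner_on J w e = cinner_on J (Y i) e + cinner_on J (Y k) e"
      using cinner_on_add_left[of J "Y i" 1 "Y k" e] by (simp add: w_def)
    have ippos: "Re (cinner_on J w e) > 0" using ip i(2) nn[OF k] by simp
    have q0: "q > 0"
    proof -
      have "q \<noteq> 0"
      proof
        assume "q = 0"
        then have "w = (\<lambda>_. 0)" using sqnorm_on_eq_0[OF fin(1) V(1) wV] by (simp add: q_def)
        then show False using ippos by (simp add: cinner_on_def)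
      qed
      then show ?thesis using sqnorm_on_nonneg[of J w] by (simp add: q_def)
    qed
    \<comment> \<open>Strict convexity, by the parallelogram law for the distinct unit vectors \<open>Y i\<close> and \<open>Y k\<close>.\<close>
    have q4: "q < 4"
    proof -
      define d where "d = (\<lambda>j. Y i j + (-1) * Y k j)"
      have dV: "d \<in> V" unfolding d_def using subspace_onD[OF V(1)] YV i(1) k by blast
      have "sqnorm_on J d \<noteq> 0"
      proof
        assume "sqnorm_on J d = 0"
        then have "d = (\<lambda>_. 0)" using sqnorm_on_eq_0[OF fin(1) V(1) dV] by simp
        then have "Y i j = Y k j" for j by (auto simp: d_def dest: fun_cong[of _ _ j])
        then show False using ne by auto
      qed
      then have "sqnorm_on J d > 0" using sqnorm_on_nonneg[of J d] by simp
      moreover have "q + sqnorm_on J d = 4"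
        using sqnorm_on_add[of J "Y i" 1 "Y k"] sqnorm_on_add[of J "Y i" "-1" "Y k"] YV(2)[OF k] YV(2)[OF i(1)]
        by (simp add: q_def w_def d_def)
      ultimately show ?thesis by simp
    qed
    define a where "a = 1 / sqrt q"
    have a: "a > 1 / 2" 
    proof -
      have "sqrt q < 2" using q4 real_sqrt_less_mono[of q 4] by simp
      then show ?thesis unfolding a_def using q0 by (simp add: field_simps)
    qed
    have aq: "a\<^sup>2 * q = 1" using q0 by (simp add: a_def power_divide)
    define u where "u = (\<lambda>j. complex_of_real a * w j)"
    have uV: "u \<in> V" unfolding u_def by (rule subspace_on_scale[OF V(1) wV])
    have un: "sqnorm_on J u = 1" unfolding u_def sqnorm_on_scale using aq by (simp add: q_def)
    define Z where "Z = Y(i := u, k := u)"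
    have scaleB: "B (\<lambda>j. c * x j) z = c * B x z" for c x z
      using lin[of x "c - 1" x z] by (simp add: algebra_simps)
    have "L Z = B u u" by (simp add: Z_def B_def)
    also have "\<dots> = of_real a * (of_real a * B w w)"
      unfolding u_def scaleB by (subst symB) (simp add: scaleB)
    also have "\<dots> = of_real (a\<^sup>2 * q) * L Y" by (simp add: w power2_eq_square)
    finally have "L Z = L Y" using aq by simp
    moreover have "Z \<in> \<Omega>" unfolding Z_def by (intro upd Y\<Omega> uV un)
    ultimately have "P Z \<le> P Y" using LY by (intro Y(2)) (simp add: \<Omega>'_def)
    moreover have "P Z = P Y + (2 * a - 1) * Re (cinner_on J w e)"
    proof -
      have split: "P T = Re (cinner_on J (T i) e) + Re (cinner_on J (T k) e) +
          (\<Sum>l\<in>K-{i}-{k}. Re (cinner_on J (T l) e))" for T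
        unfolding P_def using i(1) k ki fin(2)
        by (simp add: sum.remove[of K i] sum.remove[of "K-{i}" k])
      have "(\<Sum>l\<in>K-{i}-{k}. Re (cinner_on J (Z l) e)) = (\<Sum>l\<in>K-{i}-{k}. Re (cinner_on J (Y l) e))"
        by (intro sum.cong) (auto simp: Z_def)
      moreover have "cinner_on J u e = of_real a * cinner_on J w e"
        by (simp add: u_def cinner_on_def sum_distrib_left mult.assoc)
      ultimately show ?thesis
        unfolding split using ki by (simp add: Z_def ip algebra_simps)
    qed
    moreover have "(2 * a - 1) * Re (cinner_on J w e) > 0" using a ippos by simp
    ultimately show False by simp
  qed
  have "cmod (L X) \<le> s" using X0(2)[OF X'] LX' by (simp add: s_def)
  also have "L Y = L (\<lambda>_. Y i)" by (rule cong) (rule all_eq)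
  then have "s = cmod (L (\<lambda>_. Y i))" using LY by simp
  also have "\<dots> \<le> M" by (rule diag) (use YV[OF i(1)] in auto)
  finally show ?thesis .
qed

text \<open>
  Banach's theorem that on a Hilbert space a symmetric multilinear form and its polynomial have the
  same norm. It is stated for squared norms, and on a subspace \<open>V\<close>, because the permanent will only
  be small on the vectors with zero entry sum.
\<close>

theorem polarization_constant_one:
  fixes L :: "('k \<Rightarrow> 'j \<Rightarrow> complex) \<Rightarrow> complex"
  assumes fin: "finite J" "finite K" and K: "K \<noteq> {}"
    and V: "subspace_on J V" "closed V"
    and ml: "multilinear_on K L" and sym: "symmetric_on K L"
    and cont: "continuous_on UNIV L"
    and cong: "\<And>X Y. (\<And>k. k \<in> K \<Longrightarrow> X k = Y k) \<Longrightarrow> L X = L Y"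
    and diag: "\<And>x. x \<in> V \<Longrightarrow> sqnorm_on J x = 1 \<Longrightarrow> (cmod (L (\<lambda>_. x)))\<^sup>2 \<le> M"
    and X: "\<And>k. k \<in> K \<Longrightarrow> X k \<in> V"
  shows "(cmod (L X))\<^sup>2 \<le> M * (\<Prod>k\<in>K. sqnorm_on J (X k))"
proof (cases "\<exists>k\<in>K. sqnorm_on J (X k) = 0")
  case True
  then obtain k where k: "k \<in> K" "sqnorm_on J (X k) = 0" by blast
  then have "X k = (\<lambda>j. 0 * X k j)" using sqnorm_on_eq_0[OF fin(1) V(1) X[OF k(1)]] by simp
  then have "X = X(k := \<lambda>j. 0 * X k j)" by auto
  then have "L X = 0 * L (X(k := X k))" using multilinear_on_scale_slot[OF ml k(1), of X 0 "X k"] by simp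
  then have "L X = 0" by simp
  moreover have "(\<Prod>k\<in>K. sqnorm_on J (X k)) = 0" using k fin by auto
  ultimately show ?thesis by simp
next
  case False
  define c where "c = (\<lambda>k. sqrt (sqnorm_on J (X k)))"
  have c: "c k > 0" "(c k)\<^sup>2 = sqnorm_on J (X k)" if "k \<in> K" for k
    using False that sqnorm_on_nonneg[of J "X k"] by (auto simp: c_def order_less_le)
  define Y where "Y = (\<lambda>k j. complex_of_real (1 / c k) * X k j)"
  have "cmod (L Y) \<le> sqrt M"
  proof (rule polarization_unit[OF fin K V ml sym cont cong])
    show "cmod (L (\<lambda>_. x)) \<le> sqrt M" if "x \<in> V" "sqnorm_on J x = 1" for x
      using diag[OF that] by (intro real_le_rsqrt)
    show "Y k \<in> V" if "k \<in> K" for k unfolding Y_def using X[OF that] V(1) by (intro subspace_on_scale)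
    show "sqnorm_on J (Y k) = 1" if "k \<in> K" for k
      unfolding Y_def sqnorm_on_scale using c[OF that] False that by (simp add: power_divide norm_divide)
  qed
  moreover have "L X = (\<Prod>k\<in>K. complex_of_real (c k)) * L Y"
  proof -
    have "L X = L (\<lambda>k. if k \<in> K then (\<lambda>j. complex_of_real (c k) * Y k j) else Y k)"
    proof (rule cong)
      fix k assume "k \<in> K"
      then show "X k = (if k \<in> K then (\<lambda>j. complex_of_real (c k) * Y k j) else Y k)"
        using c(1)[of k] by (simp add: Y_def fun_eq_iff)
    qed
    also have "\<dots> = (\<Prod>k\<in>K. complex_of_real (c k)) * L Y"
      by (rule multilinear_on_scale[OF ml fin(2)]) simp
    finally show ?thesis .
  qed
  moreover have "cmod (\<Prod>k\<in>K. complex_of_real (c k)) = (\<Prod>k\<in>K. c k)"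
    unfolding prod_norm[symmetric] using c(1) by (intro prod.cong) (auto simp: less_imp_le)
  ultimately have "cmod (L X) \<le> (\<Prod>k\<in>K. c k) * sqrt M"
    using c(1) by (simp add: norm_mult mult_left_mono prod_nonneg less_imp_le)
  then have "(cmod (L X))\<^sup>2 \<le> ((\<Prod>k\<in>K. c k) * sqrt M)\<^sup>2" by (intro power_mono) auto
  also have "\<dots> = M * (\<Prod>k\<in>K. (c k)\<^sup>2)"
  proof -
    have "sqrt M \<ge> 0" using \<open>cmod (L Y) \<le> sqrt M\<close> norm_ge_zero order_trans by blast
    then show ?thesis by (simp add: power_mult_distrib prod_power_distrib)
  qed
  also have "(\<Prod>k\<in>K. (c k)\<^sup>2) = (\<Prod>k\<in>K. sqnorm_on J (X k))" by (intro prod.cong) (auto simp: c)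
  finally show ?thesis .
qed

section \<open>Permanents as symmetric multilinear forms\<close>

definition inj_maps :: "'k set \<Rightarrow> 'j set \<Rightarrow> ('k \<Rightarrow> 'j) set" where
  "inj_maps K J = {f \<in> K \<rightarrow>\<^sub>E J. inj_on f K}"

text \<open>
  The permanent of a rectangular matrix over arbitrary finite index sets; its columns will range over
  subsets of the columns of the given matrix.
\<close>

definition perm_on :: "'j set \<Rightarrow> 'k set \<Rightarrow> ('j \<Rightarrow> 'k \<Rightarrow> 'a) \<Rightarrow> 'a :: comm_semiring_1" where
  "perm_on J K a = (\<Sum>f\<in>inj_maps K J. \<Prod>k\<in>K. a (f k) k)"

text \<open>
  The elementary symmetric polynomial of degree \<open>m\<close> in the \<open>y i\<close>.
\<close>

definition esym :: "'j set \<Rightarrow> nat \<Rightarrow> ('j \<Rightarrow> 'a) \<Rightarrow> 'a :: comm_semiring_1" where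
  "esym S m y = (\<Sum>T | T \<subseteq> S \<and> card T = m. \<Prod>i\<in>T. y i)"

lemma finite_inj_maps [simp]: "finite K \<Longrightarrow> finite J \<Longrightarrow> finite (inj_maps K J)"
  unfolding inj_maps_def by (rule finite_subset[of _ "K \<rightarrow>\<^sub>E J"]) (auto intro: finite_PiE)

lemma perm_on_cong:
  "(\<And>j k. j \<in> J \<Longrightarrow> k \<in> K \<Longrightarrow> a j k = b j k) \<Longrightarrow> perm_on J K a = perm_on J K b"
  unfolding perm_on_def inj_maps_def by (intro sum.cong prod.cong) auto

lemma multilinear_on_perm:
  assumes "finite K"
  shows "multilinear_on K (\<lambda>X. perm_on J K (\<lambda>j k. X k j))"
proof -
  have expand: "(\<Prod>i\<in>K. (X(k := w)) i (f i)) = w (f k) * (\<Prod>i\<in>K - {k}. X i (f i))"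
    if "k \<in> K" for X :: "'a \<Rightarrow> 'b \<Rightarrow> complex" and k w f
  proof -
    have "(\<Prod>i\<in>K - {k}. (X(k := w)) i (f i)) = (\<Prod>i\<in>K - {k}. X i (f i))"
      by (intro prod.cong) auto
    then show ?thesis using prod.remove[OF assms that, of "\<lambda>i. (X(k := w)) i (f i)"] by simp
  qed
  show ?thesis
    unfolding multilinear_on_def perm_on_def
    by (simp add: expand distrib_right sum.distrib sum_distrib_left mult.assoc del: fun_upd_apply)
qed

text \<open>
  Exchanging two columns amounts to composing each injection with a transposition.
\<close>

lemma symmetric_on_perm:
  fixes K :: "'k set" and J :: "'j set"
  shows "symmetric_on K (\<lambda>X. perm_on J K (\<lambda>j k. X k j) :: complex)"
  unfolding symmetric_on_def
proof (intro allI ballI impI)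
  fix X :: "'k \<Rightarrow> 'j \<Rightarrow> complex" and i k u v
  assume ik: "i \<in> K" "k \<in> K" "i \<noteq> k"
  let ?\<tau> = "\<lambda>l. if l = i then k else if l = k then i else l"
  have bij: "bij_betw ?\<tau> K K"
    using ik by (intro bij_betw_byWitness[where f' = ?\<tau>]) auto
  have mem: "(\<lambda>l. f (?\<tau> l)) \<in> inj_maps K J" if "f \<in> inj_maps K J" for f
  proof -
    have "inj_on (f \<circ> ?\<tau>) K"
      using that bij by (intro comp_inj_on) (auto simp: inj_maps_def bij_betw_def)
    moreover have "(\<lambda>l. f (?\<tau> l)) \<in> K \<rightarrow>\<^sub>E J"
      using that ik by (auto simp: inj_maps_def PiE_def Pi_def extensional_def)
    ultimately show ?thesis by (simp add: inj_maps_def comp_def)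
  qed
  show "perm_on J K (\<lambda>j l. (X(i := u, k := v)) l j) = perm_on J K (\<lambda>j l. (X(i := v, k := u)) l j)"
    unfolding perm_on_def
  proof (rule sum.reindex_bij_witness[where i = "\<lambda>f l. f (?\<tau> l)" and j = "\<lambda>f l. f (?\<tau> l)"])
    fix f assume f: "f \<in> inj_maps K J"
    have "(\<Prod>l\<in>K. (X(i := v, k := u)) l (f (?\<tau> l))) = (\<Prod>l\<in>K. (X(i := u, k := v)) (?\<tau> l) (f (?\<tau> l)))"
      using ik by (intro prod.cong) auto
    also have "\<dots> = (\<Prod>l\<in>K. (X(i := u, k := v)) l (f l))"
      by (rule prod.reindex_bij_betw[OF bij])
    finally show "(\<Prod>l\<in>K. (X(i := v, k := u)) l (f (?\<tau> l))) = (\<Prod>l\<in>K. (X(i := u, k := v)) l (f l))" .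
    show "(\<lambda>l. f (?\<tau> l)) \<in> inj_maps K J" by (rule mem[OF f])
    then show "(\<lambda>l. f (?\<tau> l)) \<in> inj_maps K J" .
    show "(\<lambda>l. f (?\<tau> (?\<tau> l))) = f" by (rule ext) simp
    then show "(\<lambda>l. f (?\<tau> (?\<tau> l))) = f" .
  qed
qed

lemma continuous_on_perm:
  "continuous_on A (\<lambda>X. perm_on J K (\<lambda>j k. X k j) :: complex)"
  unfolding perm_on_def
  by (intro continuous_on_sum continuous_on_prod continuous_on_entry)

text \<open>
  The polynomial that belongs to the permanent, regarded as a symmetric multilinear form in its columns:
  every set of rows is the image of as many injections as there are orderings of it.
\<close>

lemma perm_on_equal_columns:
  assumes "finite J" "finite K"
  shows "perm_on J K (\<lambda>j k. x j) = fact (card K) * esym J (card K) (x :: 'j \<Rightarrow> complex)"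
proof -
  let ?S = "{T. T \<subseteq> J \<and> card T = card K}"
  have fibre: "card {f \<in> inj_maps K J. f ` K = T} = fact (card K)" if T: "T \<in> ?S" for T
  proof -
    have finT: "finite T" using T assms finite_subset by auto
    have "{f \<in> inj_maps K J. f ` K = T} = {f \<in> K \<rightarrow>\<^sub>E T. inj_on f K}"
    proof (intro set_eqI iffI)
      fix f assume f: "f \<in> {f \<in> K \<rightarrow>\<^sub>E T. inj_on f K}"
      then have "f ` K \<subseteq> T" "card (f ` K) = card T" using T by (auto simp: card_image)
      then have "f ` K = T" using finT by (simp add: card_subset_eq)
      then show "f \<in> {f \<in> inj_maps K J. f ` K = T}"
        using f T by (auto simp: inj_maps_def PiE_def Pi_def)
    qed (auto simp: inj_maps_def PiE_def)
    then show ?thesis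
      using T assms finT card_inj_on_subset_funcset[of K T K] by (simp add: fact_prod_rev)
  qed
  have "perm_on J K (\<lambda>j k. x j) = (\<Sum>f\<in>inj_maps K J. \<Prod>j\<in>f ` K. x j)"
    unfolding perm_on_def by (intro sum.cong) (auto simp: inj_maps_def prod.reindex)
  also have "\<dots> = (\<Sum>T\<in>?S. \<Sum>f\<in>{f \<in> inj_maps K J. f ` K = T}. \<Prod>j\<in>f ` K. x j)"
    using assms by (intro sum.group[symmetric] finite_inj_maps) (auto simp: inj_maps_def card_image)
  also have "\<dots> = (\<Sum>T\<in>?S. fact (card K) * (\<Prod>j\<in>T. x j))"
  proof (rule sum.cong[OF refl])
    fix T assume T: "T \<in> ?S"
    have "(\<Sum>f\<in>{f \<in> inj_maps K J. f ` K = T}. \<Prod>j\<in>f ` K. x j)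
        = (\<Sum>f\<in>{f \<in> inj_maps K J. f ` K = T}. \<Prod>j\<in>T. x j)"
      by (intro sum.cong) auto
    then show "(\<Sum>f\<in>{f \<in> inj_maps K J. f ` K = T}. \<Prod>j\<in>f ` K. x j) = fact (card K) * (\<Prod>j\<in>T. x j)"
      using fibre[OF T] by simp
  qed
  finally show ?thesis by (simp add: esym_def sum_distrib_left)
qed

section \<open>Elementary symmetric polynomials\<close>

lemma esym_0 [simp]: "finite S \<Longrightarrow> esym S 0 y = 1"
proof -
  assume "finite S"
  then have "{T. T \<subseteq> S \<and> card T = 0} = {{}}" by (auto dest: finite_subset)
  then show ?thesis by (simp add: esym_def)
qed

lemma esym_insert:
  assumes "finite S" "a \<notin> S"
  shows "esym (insert a S) (Suc m) y = esym S (Suc m) y + y a * esym S m y"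
proof -
  have eq: "{T. T \<subseteq> insert a S \<and> card T = Suc m} =
     {T. T \<subseteq> S \<and> card T = Suc m} \<union> insert a ` {T. T \<subseteq> S \<and> card T = m}" (is "?A = ?B \<union> ?C")
  proof (intro set_eqI iffI)
    fix T assume T: "T \<in> ?A"
    show "T \<in> ?B \<union> ?C"
    proof (cases "a \<in> T")
      case True
      then have "T = insert a (T - {a})" "T - {a} \<subseteq> S" "card (T - {a}) = m" using T by auto
      then show ?thesis by blast
    qed (use T in auto)
  next
    fix T assume "T \<in> ?B \<union> ?C"
    then show "T \<in> ?A"
    proof
      assume "T \<in> ?C"
      then obtain R where R: "T = insert a R" "R \<subseteq> S" "card R = m" by auto
      then have "finite R" "a \<notin> R" using assms finite_subset by auto
      then show "T \<in> ?A" using R by auto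
    qed auto
  qed
  have inj: "inj_on (insert a) {T. T \<subseteq> S \<and> card T = m}"
    using assms by (auto simp: inj_on_def insert_ident subset_iff)
  have "esym (insert a S) (Suc m) y = (\<Sum>T | T \<subseteq> S \<and> card T = Suc m. \<Prod>i\<in>T. y i) +
      (\<Sum>T\<in>insert a ` {T. T \<subseteq> S \<and> card T = m}. \<Prod>i\<in>T. y i)"
    unfolding esym_def eq using assms by (intro sum.union_disjoint) auto
  also have "(\<Sum>T\<in>insert a ` {T. T \<subseteq> S \<and> card T = m}. \<Prod>i\<in>T. y i) =
      (\<Sum>T | T \<subseteq> S \<and> card T = m. y a * (\<Prod>i\<in>T. y i))"
    unfolding sum.reindex[OF inj] comp_def
  proof (intro sum.cong refl)
    fix T assume "T \<in> {T. T \<subseteq> S \<and> card T = m}"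
    then have "finite T" "a \<notin> T" using assms finite_subset by auto
    then show "(\<Prod>i\<in>insert a T. y i) = y a * (\<Prod>i\<in>T. y i)" by simp
  qed
  finally show ?thesis by (simp add: esym_def sum_distrib_left)
qed

lemma esym_card: "finite S \<Longrightarrow> esym S (card S) y = (\<Prod>i\<in>S. y i)"
proof -
  assume "finite S"
  then have "{T. T \<subseteq> S \<and> card T = card S} = {S}" by (auto dest: card_subset_eq)
  then show ?thesis by (simp add: esym_def)
qed

lemma power_ge_tangent:
  fixes s b :: real
  assumes "s \<ge> 0" "b \<ge> 0"
  shows "b ^ Suc m \<ge> s ^ Suc m + real (Suc m) * s ^ m * (b - s)"
proof (cases "s = 0")
  case True
  then show ?thesis using assms by (cases m) auto
next
  case False
  then have s: "s > 0" using assms by simp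
  have "1 + real (Suc m) * (b / s - 1) \<le> (1 + (b / s - 1)) ^ Suc m"
    using assms s by (intro Bernoulli_inequality) simp
  then have "s ^ Suc m * (1 + real (Suc m) * (b / s - 1)) \<le> s ^ Suc m * (b / s) ^ Suc m"
    using s by (intro mult_left_mono) auto
  also have "s ^ Suc m * (b / s) ^ Suc m = b ^ Suc m"
    using s by (simp add: power_divide)
  also have "s ^ Suc m * (1 + real (Suc m) * (b / s - 1)) = s ^ Suc m + real (Suc m) * s ^ m * (b - s)"
    using s by (simp add: field_simps)
  finally show ?thesis .
qed

text \<open>
  One of Maclaurin's inequalities. With \<open>s\<close> the mean of the old variables and \<open>b\<close> the mean
  after a variable is added, the recursion \<open>esym_insert\<close> bounds the new polynomial by
  the tangent of the \<open>m\<close>-th power at \<open>s\<close>, evaluated at \<open>b\<close>, times the binomial coefficient, and the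
  power lies above its tangent.
\<close>

lemma maclaurin_esym_le:
  fixes y :: "'a \<Rightarrow> real"
  assumes "finite S" "\<And>i. i \<in> S \<Longrightarrow> y i \<ge> 0"
  shows "esym S m y \<le> real (card S choose m) * ((\<Sum>i\<in>S. y i) / card S) ^ m"
  using assms
proof (induction S arbitrary: m rule: finite_induct)
  case empty
  show ?case
  proof (cases m)
    case (Suc k)
    then have none: "{T. T \<subseteq> ({}::'a set) \<and> card T = m} = {}" by auto
    show ?thesis unfolding esym_def none using Suc by simp
  qed simp
next
  case (insert a S)
  show ?case
  proof (cases m)
    case 0
    then show ?thesis using insert.hyps by simp
  next
    case (Suc k)
    define n where "n = card S"
    define s where "s = (\<Sum>i\<in>S. y i) / real n"
    have sum: "(\<Sum>i\<in>S. y i) = real n * s"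
    proof (cases "n = 0")
      case True
      then show ?thesis using insert.hyps by (simp add: n_def)
    qed (simp add: s_def)
    have s0: "s \<ge> 0" unfolding s_def using insert.prems by (intro divide_nonneg_nonneg sum_nonneg) auto
    have ya: "y a \<ge> 0" using insert.prems by simp
    have IH: "esym S i y \<le> real (n choose i) * s ^ i" for i
      using insert.IH[of i] insert.prems by (simp add: n_def s_def)
    define b where "b = (real n * s + y a) / (real n + 1)"
    have b0: "b \<ge> 0" unfolding b_def using s0 ya by (intro divide_nonneg_nonneg) auto
    have bs: "(real n + 1) * (b - s) = y a - s" by (simp add: b_def field_simps)
    have "esym (insert a S) m y = esym S (Suc k) y + y a * esym S k y"
      using esym_insert insert.hyps Suc by metis
    also have "\<dots> \<le> real (n choose Suc k) * s ^ Suc k + y a * (real (n choose k) * s ^ k)"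
      by (intro add_mono IH mult_left_mono ya)
    also have "\<dots> = real (Suc n choose Suc k) * s ^ Suc k + real (n choose k) * s ^ k * (y a - s)"
      by (simp add: algebra_simps)
    also have "\<dots> = real (Suc n choose Suc k) * s ^ Suc k + (real (Suc n) * real (n choose k)) * s ^ k * (b - s)"
      unfolding bs[symmetric] by (simp add: algebra_simps)
    also have "real (Suc n) * real (n choose k) = real (Suc n choose Suc k) * real (Suc k)"
      using Suc_times_binomial_eq[of n k] by (simp only: of_nat_mult[symmetric])
    also have "real (Suc n choose Suc k) * s ^ Suc k + real (Suc n choose Suc k) * real (Suc k) * s ^ k * (b - s)
      = real (Suc n choose Suc k) * (s ^ Suc k + real (Suc k) * s ^ k * (b - s))"
      by (simp only: distrib_left mult.assoc)
    also have "\<dots> \<le> real (Suc n choose Suc k) * b ^ Suc k"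
      by (intro mult_left_mono power_ge_tangent s0 b0) simp
    finally show ?thesis
      using insert.hyps sum Suc by (simp add: b_def n_def add.commute)
  qed
qed

lemma prod_le_mean_power:
  fixes y :: "'a \<Rightarrow> real"
  assumes "finite S" "\<And>i. i \<in> S \<Longrightarrow> y i \<ge> 0"
  shows "(\<Prod>i\<in>S. y i) \<le> ((\<Sum>i\<in>S. y i) / card S) ^ card S"
  using maclaurin_esym_le[of S y "card S"] assms(2) assms(1) by (simp add: esym_card)

lemma prod_add_eq_sum_esym:
  fixes x :: "'j \<Rightarrow> 'a :: comm_semiring_1"
  assumes "finite J"
  shows "(\<Prod>j\<in>J. s + c * x j) = (\<Sum>m\<le>card J. s ^ (card J - m) * c ^ m * esym J m x)"
proof -
  have "(\<Prod>j\<in>J. s + c * x j) = (\<Prod>j\<in>J. c * x j + s)" by (simp add: add.commute)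
  also have "\<dots> = (\<Sum>T\<in>Pow J. (\<Prod>j\<in>T. c * x j) * (\<Prod>j\<in>J - T. s))"
    by (rule prod_add[OF assms])
  also have "\<dots> = (\<Sum>m\<le>card J. \<Sum>T\<in>{T \<in> Pow J. card T = m}. (\<Prod>j\<in>T. c * x j) * (\<Prod>j\<in>J - T. s))"
    using assms by (intro sum.group[symmetric]) (auto intro: card_mono)
  also have "\<dots> = (\<Sum>m\<le>card J. s ^ (card J - m) * c ^ m * esym J m x)"
  proof (intro sum.cong refl)
    fix m
    have "(\<Prod>j\<in>T. c * x j) * (\<Prod>j\<in>J - T. s) = s ^ (card J - m) * c ^ m * (\<Prod>j\<in>T. x j)"
      if "T \<subseteq> J" "card T = m" for T
      using that assms finite_subset[OF that(1) assms]
      by (simp add: prod.distrib card_Diff_subset mult_ac)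
    then show "(\<Sum>T\<in>{T \<in> Pow J. card T = m}. (\<Prod>j\<in>T. c * x j) * (\<Prod>j\<in>J - T. s)) =
       s ^ (card J - m) * c ^ m * esym J m x"
      unfolding esym_def sum_distrib_left by (intro sum.cong) auto
  qed
  finally show ?thesis .
qed

text \<open>
  Cauchy's estimate for polynomials; averaging over the roots of unity of order \<open>n + 1\<close> isolates
  the coefficient without any integration.
\<close>

lemma coeff_bound_unit_circle:
  fixes c :: "nat \<Rightarrow> complex"
  assumes bound: "\<And>z. cmod z = 1 \<Longrightarrow> cmod (\<Sum>i\<le>n. c i * z ^ i) \<le> B" and k: "k \<le> n"
  shows "cmod (c k) \<le> B"
proof -
  define w where "w = (\<lambda>i::nat. cis (2 * pi * real i / real (Suc n)))"
  have w1: "cmod (w i) = 1" for i by (simp add: w_def)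
  have wpow: "w i ^ s = w s ^ i" for i s
    unfolding w_def Complex.DeMoivre by (simp add: mult_ac)
  have wn: "w i ^ Suc n = 1" for i
  proof -
    have "w i ^ Suc n = cis (2 * pi * real i)"
      unfolding w_def Complex.DeMoivre by (rule arg_cong[of _ _ cis]) (simp add: field_simps del: of_nat_Suc)
    then show ?thesis by (metis cis_multiple_2pi Ints_of_nat)
  qed
  have inj: "inj_on w {..<Suc n}"
    using Complex.bij_betw_roots_unity[of "Suc n"] unfolding w_def bij_betw_def by auto
  have nz: "w i \<noteq> 0" for i using w1[of i] by auto
  have orth: "(\<Sum>s\<le>n. (w i / w k) ^ s) = (if i = k then of_nat (Suc n) else 0)" if "i \<le> n" for i
  proof (cases "i = k")
    case True
    then show ?thesis using nz by simp
  next
    case False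
    have "w i / w k \<noteq> 1" using inj that k False nz by (auto simp: inj_on_def)
    moreover have "(w i / w k) ^ Suc n = 1" by (simp only: power_divide wn) simp
    ultimately show ?thesis using False by (simp only: sum_gp0) simp
  qed
  have "(\<Sum>s\<le>n. (\<Sum>i\<le>n. c i * w s ^ i) / w s ^ k) = (\<Sum>s\<le>n. \<Sum>i\<le>n. c i * (w i / w k) ^ s)"
    by (intro sum.cong refl) (simp add: sum_divide_distrib power_divide wpow)
  also have "\<dots> = (\<Sum>i\<le>n. c i * (\<Sum>s\<le>n. (w i / w k) ^ s))"
    by (subst sum.swap) (simp add: sum_distrib_left)
  also have "\<dots> = (\<Sum>i\<le>n. if i = k then c i * of_nat (Suc n) else 0)"
    using orth by (intro sum.cong) auto
  also have "\<dots> = c k * of_nat (Suc n)" using k by simp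
  finally have "cmod (c k) * real (Suc n) = cmod (\<Sum>s\<le>n. (\<Sum>i\<le>n. c i * w s ^ i) / w s ^ k)"
    by (simp add: norm_mult del: of_nat_Suc)
  also have "\<dots> \<le> (\<Sum>s\<le>n. B)"
    by (intro sum_norm_le) (simp add: norm_divide norm_power w1 bound)
  finally have "cmod (c k) * real (Suc n) \<le> B * real (Suc n)" by (simp add: mult.commute)
  then show ?thesis by (simp del: of_nat_Suc)
qed

text \<open>
  The elementary symmetric polynomial is, up to powers of \<open>s\<close> and \<open>t\<close>, a coefficient of
  the product of the \<open>s + t z x j\<close>. As the \<open>x j\<close> sum to zero, the mean of
  \<open>|s + t z x j|\<^sup>2\<close> on the unit circle is \<open>s\<^sup>2 + t\<^sup>2 / N\<close>, and the inequality
  between the geometric and the arithmetic mean bounds the product. The choice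
  \<open>s\<^sup>2 = (N - m) / N\<close> and \<open>t\<^sup>2 = m\<close> is the optimal one and makes this mean equal to \<open>1\<close>; for \<open>m = N\<close> it uses \<open>0\<^sup>0 = 1\<close>.
\<close>

lemma esym_centred_bound:
  fixes x :: "'j \<Rightarrow> complex"
  assumes fin: "finite J" and N: "card J = N" and m: "m \<le> N" "0 < N"
    and sum0: "(\<Sum>j\<in>J. x j) = 0" and unit: "sqnorm_on J x = 1"
  shows "(cmod (esym J m x))\<^sup>2 \<le> real N ^ (N - m) / (real (N - m) ^ (N - m) * real m ^ m)"
proof -
  define s where "s = sqrt (real (N - m) / real N)"
  define t where "t = sqrt (real m)"
  have s2: "s\<^sup>2 = real (N - m) / real N" and s0: "s \<ge> 0" by (auto simp: s_def)
  have t2: "t\<^sup>2 = real m" and t0: "t \<ge> 0" by (auto simp: t_def)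
  define c where "c = (\<lambda>i. complex_of_real s ^ (N - i) * complex_of_real t ^ i * esym J i x)"
  have bound: "cmod (\<Sum>i\<le>N. c i * z ^ i) \<le> 1" if z: "cmod z = 1" for z
  proof -
    define v where "v = complex_of_real t * z"
    have "(\<Sum>i\<le>N. c i * z ^ i) = (\<Prod>j\<in>J. complex_of_real s + v * x j)"
      unfolding prod_add_eq_sum_esym[OF fin] N by (simp add: c_def v_def power_mult_distrib mult_ac)
    then have "(cmod (\<Sum>i\<le>N. c i * z ^ i))\<^sup>2 = (\<Prod>j\<in>J. (cmod (complex_of_real s + v * x j))\<^sup>2)"
      by (simp add: prod_norm[symmetric] prod_power_distrib)
    also have "\<dots> \<le> ((\<Sum>j\<in>J. (cmod (complex_of_real s + v * x j))\<^sup>2) / card J) ^ card J"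
      by (rule prod_le_mean_power[OF fin]) simp
    also have "(\<Sum>j\<in>J. (cmod (complex_of_real s + v * x j))\<^sup>2) = real N"
    proof -
      have "(\<Sum>j\<in>J. (cmod (complex_of_real s + v * x j))\<^sup>2) = sqnorm_on J (\<lambda>j. complex_of_real s + v * x j)"
        by (simp add: sqnorm_on_def)
      also have "\<dots> = sqnorm_on J (\<lambda>j. complex_of_real s) + 2 * Re (cnj v * cinner_on J (\<lambda>j. complex_of_real s) x)
          + (cmod v)\<^sup>2 * sqnorm_on J x"
        by (rule sqnorm_on_add)
      also have "cinner_on J (\<lambda>j. complex_of_real s) x = of_real s * cnj (\<Sum>j\<in>J. x j)"
        by (simp add: cinner_on_def sum_distrib_left)
      also have "sqnorm_on J (\<lambda>j. complex_of_real s) = real N * s\<^sup>2"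
        by (simp add: sqnorm_on_def N)
      also have "(cmod v)\<^sup>2 = real m" using z t0 t2 by (simp add: v_def norm_mult power_mult_distrib)
      finally show ?thesis using m sum0 unit by (simp add: s2 of_nat_diff)
    qed
    finally have "(cmod (\<Sum>i\<le>N. c i * z ^ i))\<^sup>2 \<le> 1" using m N by simp
    then show ?thesis by (simp add: abs_square_le_1)
  qed
  have "cmod (c m) \<le> 1" by (rule coeff_bound_unit_circle[where n = N]) (use bound m in auto)
  then have "(cmod (c m))\<^sup>2 \<le> 1" by (simp add: power_le_one)
  also have "(cmod (c m))\<^sup>2 = (s\<^sup>2) ^ (N - m) * (t\<^sup>2) ^ m * (cmod (esym J m x))\<^sup>2"
  proof -
    have swap: "(y ^ p)\<^sup>2 = (y\<^sup>2) ^ p" for y :: real and p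
      by (metis power_mult mult.commute)
    have "cmod (c m) = s ^ (N - m) * t ^ m * cmod (esym J m x)"
      by (simp add: c_def norm_mult norm_power s0 t0)
    then show ?thesis by (simp only: power_mult_distrib swap)
  qed
  finally have le: "(real (N - m) / real N) ^ (N - m) * real m ^ m * (cmod (esym J m x))\<^sup>2 \<le> 1"
    by (simp only: s2 t2)
  have "real p ^ p > 0" for p :: nat by (cases "p = 0") auto
  then have pos: "real (N - m) ^ (N - m) * real m ^ m > 0" by (simp only: mult_pos_pos)
  have "(cmod (esym J m x))\<^sup>2 * (real (N - m) ^ (N - m) * real m ^ m) =
      ((real (N - m) / real N) ^ (N - m) * real m ^ m * (cmod (esym J m x))\<^sup>2) * real N ^ (N - m)"
    using m(2) by (simp only: power_divide) (simp add: mult_ac)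
  also have "\<dots> \<le> 1 * real N ^ (N - m)" by (intro mult_right_mono le) simp
  finally show ?thesis using pos by (simp only: pos_le_divide_eq mult_1)
qed

section \<open>Permanents of centred matrices\<close>

text \<open>
  A Hadamard type inequality for permanents of matrices whose columns sum to zero. The constraint on
  the columns is linear, so polarization on that subspace reduces the estimate to equal columns.
\<close>

theorem perm_centred_bound:
  fixes a :: "'j \<Rightarrow> 'k \<Rightarrow> complex"
  assumes fin: "finite J" "finite K" and N: "card J = N" and m: "card K = m" "0 < m" "m \<le> N"
    and sum0: "\<And>k. k \<in> K \<Longrightarrow> (\<Sum>j\<in>J. a j k) = 0"
  shows "(cmod (perm_on J K a))\<^sup>2 \<le>
    (fact m)\<^sup>2 * (real N ^ (N - m) / (real (N - m) ^ (N - m) * real m ^ m)) *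
    (\<Prod>k\<in>K. \<Sum>j\<in>J. (cmod (a j k))\<^sup>2)"
proof -
  define V :: "('j \<Rightarrow> complex) set" where "V = {v. (\<Sum>j\<in>J. v j) = 0 \<and> (\<forall>j. j \<notin> J \<longrightarrow> v j = 0)}"
  define X where "X = (\<lambda>k j. if j \<in> J then a j k else 0)"
  have sub: "subspace_on J V"
    by (auto simp: subspace_on_def V_def sum.distrib sum_distrib_left[symmetric])
  have closed: "closed V"
  proof -
    have "V = {v. (\<Sum>j\<in>J. v j) = 0} \<inter> (\<Inter>j\<in>-J. {v. v j = 0})" by (auto simp: V_def)
    moreover have "closed \<dots>"
      by (intro closed_Int closed_INT ballI closed_Collect_eq continuous_on_sum continuous_on_const
          continuous_on_product_coordinates)
    ultimately show ?thesis by simp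
  qed
  have "(cmod (perm_on J K (\<lambda>j k. X k j)))\<^sup>2 \<le>
    ((fact m)\<^sup>2 * (real N ^ (N - m) / (real (N - m) ^ (N - m) * real m ^ m))) *
    (\<Prod>k\<in>K. sqnorm_on J (X k))"
  proof (rule polarization_constant_one[OF fin _ sub closed multilinear_on_perm[OF fin(2)] symmetric_on_perm continuous_on_perm])
    show "perm_on J K (\<lambda>j k. X k j) = perm_on J K (\<lambda>j k. Y k j)" if "\<And>k. k \<in> K \<Longrightarrow> X k = Y k"
      for X Y :: "'k \<Rightarrow> 'j \<Rightarrow> complex"
      by (rule perm_on_cong) (simp add: that)
  next
    fix x assume x: "x \<in> V" "sqnorm_on J x = 1"
    have "(cmod (perm_on J K (\<lambda>j k. x j)))\<^sup>2 = (fact m)\<^sup>2 * (cmod (esym J m x))\<^sup>2"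
      using perm_on_equal_columns[OF fin, of x] m by (simp add: norm_mult power_mult_distrib)
    also have "\<dots> \<le> (fact m)\<^sup>2 * (real N ^ (N - m) / (real (N - m) ^ (N - m) * real m ^ m))"
      using x m by (intro mult_left_mono esym_centred_bound[OF fin(1) N]) (auto simp: V_def)
    finally show "(cmod (perm_on J K (\<lambda>j k. x j)))\<^sup>2 \<le> \<dots>" .
  next
    show "X k \<in> V" if "k \<in> K" for k using sum0[OF that] by (auto simp: V_def X_def)
  qed (use m in auto)
  moreover have "perm_on J K (\<lambda>j k. X k j) = perm_on J K a"
    by (rule perm_on_cong) (simp add: X_def)
  moreover have "sqnorm_on J (X k) = (\<Sum>j\<in>J. (cmod (a j k))\<^sup>2)" for k
    by (simp add: sqnorm_on_def X_def)
  ultimately show ?thesis by simp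
qed

section \<open>Coefficients of squarefree monomials\<close>

definition sqfree_monom :: "nat set \<Rightarrow> (nat \<Rightarrow>\<^sub>0 nat)" where
  "sqfree_monom K = (\<Sum>k\<in>K. Poly_Mapping.single k 1)"

text \<open>
  Only coefficients of squarefree monomials enter, and these can be computed within themselves, since a divisor
  of a squarefree monomial is squarefree.
\<close>

definition sqfree_coeff :: "nat set \<Rightarrow> cpoly \<Rightarrow> complex" where
  "sqfree_coeff K p = Poly_Mapping.lookup p (sqfree_monom K)"

lemma lookup_sqfree_monom:
  "finite K \<Longrightarrow> Poly_Mapping.lookup (sqfree_monom K) i = (if i \<in> K then 1 else 0)"
  by (simp add: sqfree_monom_def lookup_sum lookup_single when_def)

lemma inj_on_sqfree_monom: "inj_on sqfree_monom {K. finite K}"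
proof (rule inj_onI)
  fix K L assume fin: "K \<in> {K. finite K}" "L \<in> {K. finite K}" and eq: "sqfree_monom K = sqfree_monom L"
  have "(i \<in> K) = (i \<in> L)" for i
    using arg_cong[OF eq, of "\<lambda>m. Poly_Mapping.lookup m i"] fin
    by (simp add: lookup_sqfree_monom split: if_splits)
  then show "K = L" by auto
qed

lemma sqfree_monom_split:
  assumes "finite K" "L \<subseteq> K"
  shows "sqfree_monom K = sqfree_monom L + sqfree_monom (K - L)"
  unfolding sqfree_monom_def using sum.subset_diff[OF assms(2,1)] by (simp add: add.commute)

text \<open>
  The exponents of \<open>l\<close> and \<open>r\<close> add up to \<open>0\<close> or \<open>1\<close>, so both are \<open>0\<close> or \<open>1\<close> themselves.
\<close>

lemma sqfree_monom_eq_add: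
  assumes K: "finite K" and eq: "sqfree_monom K = l + r"
  shows "l \<in> sqfree_monom ` Pow K"
proof
  define L where "L = {i \<in> K. Poly_Mapping.lookup l i = 1}"
  have finL: "finite L" using K by (simp add: L_def)
  show "L \<in> Pow K" by (auto simp: L_def)
  show "l = sqfree_monom L"
  proof (rule poly_mapping_eqI)
    fix i
    have "Poly_Mapping.lookup l i + Poly_Mapping.lookup r i = (if i \<in> K then 1 else 0)"
      using lookup_sqfree_monom[OF K, of i] by (simp add: eq lookup_add)
    then show "Poly_Mapping.lookup l i = Poly_Mapping.lookup (sqfree_monom L) i"
      unfolding lookup_sqfree_monom[OF finL] by (auto simp: L_def split: if_splits)
  qed
qed

lemma sqfree_coeff_mult:
  assumes K: "finite K"
  shows "sqfree_coeff K (p * q) = (\<Sum>L\<in>Pow K. sqfree_coeff L p * sqfree_coeff (K - L) q)"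
proof -
  let ?inner = "\<lambda>l. \<Sum>r. Poly_Mapping.lookup q r when sqfree_monom K = l + r"
  have inner: "?inner (sqfree_monom L) = sqfree_coeff (K - L) q" if "L \<subseteq> K" for L
  proof -
    have "sqfree_monom K = sqfree_monom L + r \<longleftrightarrow> r = sqfree_monom (K - L)" for r
      unfolding sqfree_monom_split[OF K that] by auto
    then show ?thesis by (simp add: sqfree_coeff_def)
  qed
  have "?inner l = 0" if "l \<notin> sqfree_monom ` Pow K" for l
  proof -
    have "sqfree_monom K \<noteq> l + r" for r using sqfree_monom_eq_add[OF K] that by blast
    then show ?thesis by simp
  qed
  then have "sqfree_coeff K (p * q) = (\<Sum>l\<in>sqfree_monom ` Pow K. Poly_Mapping.lookup p l * ?inner l)"
    unfolding sqfree_coeff_def lookup_mult using K by (intro Sum_any.expand_superset) auto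
  also have "\<dots> = (\<Sum>L\<in>Pow K. Poly_Mapping.lookup p (sqfree_monom L) * ?inner (sqfree_monom L))"
    using K finite_subset by (subst sum.reindex) (auto intro!: inj_on_subset[OF inj_on_sqfree_monom])
  also have "\<dots> = (\<Sum>L\<in>Pow K. sqfree_coeff L p * sqfree_coeff (K - L) q)"
    by (intro sum.cong refl) (simp add: inner, simp add: sqfree_coeff_def)
  finally show ?thesis .
qed

lemma sqfree_coeff_add: "sqfree_coeff K (p + q) = sqfree_coeff K p + sqfree_coeff K q"
  by (simp add: sqfree_coeff_def lookup_add)

lemma sqfree_coeff_one:
  assumes "finite K"
  shows "sqfree_coeff K 1 = (if K = {} then 1 else 0)"
proof -
  have "sqfree_monom K = 0 \<longleftrightarrow> K = {}"
    using assms inj_onD[OF inj_on_sqfree_monom, of K "{}"] by (auto simp: sqfree_monom_def)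
  then show ?thesis by (auto simp: sqfree_coeff_def lookup_one)
qed

text \<open>
  With \<open>I = {1..n}\<close> this covers both the \<open>U\<^sub>j\<close> and the linear form in the column means.
\<close>

definition linear_form :: "nat set \<Rightarrow> (nat \<Rightarrow> complex) \<Rightarrow> cpoly" where
  "linear_form I w = (\<Sum>k\<in>I. const_poly (w k) * indet k)"

lemma sqfree_coeff_linear_form:
  assumes "finite K"
  shows "sqfree_coeff K (linear_form I w) = (\<Sum>k\<in>I. if K = {k} then w k else 0)"
proof -
  have "Poly_Mapping.single k (Suc 0) = sqfree_monom K \<longleftrightarrow> K = {k}" for k
    using assms inj_onD[OF inj_on_sqfree_monom, of K "{k}"] by (auto simp: sqfree_monom_def)
  then have "Poly_Mapping.lookup (const_poly (w k) * indet k) (sqfree_monom K) = (if K = {k} then w k else 0)" for k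
    by (simp add: const_poly_def indet_def mult_single lookup_single when_def)
  then show ?thesis by (simp add: sqfree_coeff_def linear_form_def lookup_sum)
qed

lemma sqfree_coeff_linear_form_mult:
  assumes I: "finite I" and K: "K \<subseteq> I"
  shows "sqfree_coeff K (linear_form I w * q) = (\<Sum>k\<in>K. w k * sqfree_coeff (K - {k}) q)"
proof -
  have finK: "finite K" using I K finite_subset by blast
  have "sqfree_coeff K (linear_form I w * q) =
      (\<Sum>L\<in>Pow K. \<Sum>k\<in>I. if L = {k} then w k * sqfree_coeff (K - {k}) q else 0)"
    unfolding sqfree_coeff_mult[OF finK]
  proof (intro sum.cong refl)
    fix L assume "L \<in> Pow K"
    then have "finite L" using finK finite_subset by auto
    then show "sqfree_coeff L (linear_form I w) * sqfree_coeff (K - L) q =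
       (\<Sum>k\<in>I. if L = {k} then w k * sqfree_coeff (K - {k}) q else 0)"
      unfolding sqfree_coeff_linear_form[OF \<open>finite L\<close>] sum_distrib_right by (intro sum.cong) auto
  qed
  also have "\<dots> = (\<Sum>k\<in>I. \<Sum>L\<in>Pow K. if L = {k} then w k * sqfree_coeff (K - {k}) q else 0)"
    by (rule sum.swap)
  also have "\<dots> = (\<Sum>k\<in>I. if k \<in> K then w k * sqfree_coeff (K - {k}) q else 0)"
    using finK by (intro sum.cong refl) auto
  also have "\<dots> = (\<Sum>k\<in>K. w k * sqfree_coeff (K - {k}) q)"
    using I K by (simp add: sum.If_cases Int_absorb1)
  finally show ?thesis .
qed

text \<open>
  Each factor of the power must contribute a different indeterminate of \<open>K\<close>, in one of \<open>p!\<close> orders.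
\<close>

lemma sqfree_coeff_linear_form_power:
  assumes I: "finite I" and K: "K \<subseteq> I"
  shows "sqfree_coeff K (linear_form I w ^ p) = (if card K = p then fact p * (\<Prod>k\<in>K. w k) else 0)"
  using K
proof (induction p arbitrary: K)
  case 0
  then have "finite K" using I finite_subset by auto
  then show ?case by (auto simp: sqfree_coeff_one)
next
  case (Suc p)
  have finK: "finite K" using I Suc.prems finite_subset by blast
  have "sqfree_coeff K (linear_form I w ^ Suc p) = (\<Sum>k\<in>K. w k * sqfree_coeff (K - {k}) (linear_form I w ^ p))"
    using sqfree_coeff_linear_form_mult[OF I Suc.prems] by simp
  also have "\<dots> = (\<Sum>k\<in>K. if card K = Suc p then fact p * (\<Prod>k\<in>K. w k) else 0)"
  proof (intro sum.cong refl)
    fix k assume k: "k \<in> K"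
    then have card: "card (K - {k}) = card K - 1" "card K > 0" using finK card_gt_0_iff by auto
    have IH: "sqfree_coeff (K - {k}) (linear_form I w ^ p) =
        (if card (K - {k}) = p then fact p * (\<Prod>k\<in>K - {k}. w k) else 0)"
      using Suc.prems by (intro Suc.IH) auto
    show "w k * sqfree_coeff (K - {k}) (linear_form I w ^ p) = (if card K = Suc p then fact p * (\<Prod>k\<in>K. w k) else 0)"
    proof (cases "card K = Suc p")
      case True
      then show ?thesis using IH card prod.remove[OF finK k, of w] by simp
    next
      case False
      then have "card (K - {k}) \<noteq> p" using card by linarith
      then show ?thesis using IH False by simp
    qed
  qed
  also have "\<dots> = (if card K = Suc p then fact (Suc p) * (\<Prod>k\<in>K. w k) else 0)"
    by (simp add: algebra_simps)
  finally show ?case .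
qed

lemma perm_on_empty_columns [simp]: "perm_on J {} a = 1"
  by (simp add: perm_on_def inj_maps_def)

lemma perm_on_empty_rows: "perm_on ({} :: 'a set) K a = (if K = {} then 1 else 0)"
proof (cases "K = {}")
  case False
  then have "K \<rightarrow>\<^sub>E ({} :: 'a set) = {}" by (auto simp: PiE_eq_empty_iff)
  then show ?thesis using False by (simp add: perm_on_def inj_maps_def)
qed simp

text \<open>
  Expansion of the permanent along a row: an injection either misses the row \<open>j\<close> or takes the
  value \<open>j\<close> at exactly one column. This is the recursion that the coefficients of the products of
  \<open>1 + U\<^sub>j\<close> satisfy.
\<close>

lemma perm_on_insert_row:
  assumes fin: "finite J" "finite K" and j: "j \<notin> J"
  shows "perm_on (insert j J) K a = perm_on J K a + (\<Sum>k\<in>K. a j k * perm_on J (K - {k}) a)"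
proof -
  let ?hit = "{f \<in> inj_maps K (insert j J). j \<in> f ` K}"
  have disj: "inj_maps K (insert j J) = inj_maps K J \<union> ?hit" "inj_maps K J \<inter> ?hit = {}"
    using j by (auto simp: inj_maps_def PiE_def Pi_def)
  have finI: "finite (inj_maps K (insert j J))" using fin by simp
  have "perm_on (insert j J) K a = perm_on J K a + (\<Sum>f\<in>?hit. \<Prod>k\<in>K. a (f k) k)"
    unfolding perm_on_def
    by (subst disj(1), rule sum.union_disjoint) (use finI fin disj in auto)
  also have "(\<Sum>f\<in>?hit. \<Prod>k\<in>K. a (f k) k) =
     (\<Sum>(k, g)\<in>(SIGMA k:K. inj_maps (K - {k}) J). a j k * (\<Prod>i\<in>K - {k}. a (g i) i))"
  proof (rule sum.reindex_bij_witness[where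
        i = "\<lambda>(k, g). g(k := j)" and j = "\<lambda>f. (the_inv_into K f j, f(the_inv_into K f j := undefined))"], goal_cases)
    case (1 f)
    then show ?case by (auto simp: f_the_inv_into_f inj_maps_def)
  next
    case (2 f)
    define k where "k = the_inv_into K f j"
    have k: "k \<in> K" "f k = j"
      using 2 by (auto simp: k_def inj_maps_def f_the_inv_into_f the_inv_into_into)
    have f: "f \<in> K \<rightarrow>\<^sub>E insert j J" "inj_on f K" using 2 by (auto simp: inj_maps_def)
    have ne: "f i \<noteq> j" if "i \<in> K" "i \<noteq> k" for i using f(2) k that by (auto simp: inj_on_def)
    have "f(k := undefined) \<in> inj_maps (K - {k}) J"
      using f ne by (auto simp: inj_maps_def PiE_def Pi_def extensional_def inj_on_def)
    then show ?case using k by (simp add: k_def)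
  next
    case (3 b)
    then obtain k g where b: "b = (k, g)" "k \<in> K" "g \<in> inj_maps (K - {k}) J" by auto
    have inj: "inj_on (g(k := j)) K"
      using b(3) j by (auto simp: inj_maps_def inj_on_def PiE_def Pi_def)
    have "the_inv_into K (g(k := j)) j = k"
      using b(2) by (intro the_inv_into_f_eq[OF inj]) auto
    moreover have "g k = undefined" using b(3) by (auto simp: inj_maps_def PiE_def extensional_def)
    ultimately show ?case by (auto simp: b(1))
  next
    case (4 b)
    then obtain k g where b: "b = (k, g)" "k \<in> K" "g \<in> inj_maps (K - {k}) J" by auto
    have inj: "inj_on (g(k := j)) K"
      using b(3) j by (auto simp: inj_maps_def inj_on_def PiE_def Pi_def)
    then show ?case using b by (auto simp: inj_maps_def PiE_def Pi_def extensional_def)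
  next
    case (5 f)
    define k where "k = the_inv_into K f j"
    have k: "k \<in> K" "f k = j"
      using 5 by (auto simp: k_def inj_maps_def f_the_inv_into_f the_inv_into_into)
    have "(\<Prod>i\<in>K - {k}. a ((f(k := undefined)) i) i) = (\<Prod>i\<in>K - {k}. a (f i) i)"
      by (intro prod.cong) auto
    then show ?case using prod.remove[OF fin(2) k(1), of "\<lambda>i. a (f i) i"] k by (simp add: k_def)
  qed
  also have "\<dots> = (\<Sum>k\<in>K. a j k * perm_on J (K - {k}) a)"
    using fin by (subst sum.Sigma[symmetric]) (auto simp: perm_on_def sum_distrib_left)
  finally show ?thesis .
qed

lemma sqfree_coeff_prod_linear_forms:
  assumes I: "finite I" and K: "K \<subseteq> I" and J: "finite J"
  shows "sqfree_coeff K (\<Prod>j\<in>J. 1 + linear_form I (a j)) = perm_on J K a"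
  using J K
proof (induction J arbitrary: K rule: finite_induct)
  case empty
  then have "finite K" using I finite_subset by auto
  then show ?case by (simp add: perm_on_empty_rows sqfree_coeff_one)
next
  case (insert j J)
  have finK: "finite K" using I insert.prems finite_subset by blast
  let ?P = "\<Prod>j\<in>J. 1 + linear_form I (a j)"
  have sub: "sqfree_coeff (K - {k}) ?P = perm_on J (K - {k}) a" for k
    using insert.prems by (intro insert.IH) auto
  have "sqfree_coeff K (\<Prod>j\<in>insert j J. 1 + linear_form I (a j)) = sqfree_coeff K (?P + linear_form I (a j) * ?P)"
    using insert.hyps by (simp add: distrib_right)
  also have "\<dots> = perm_on J K a + (\<Sum>k\<in>K. a j k * perm_on J (K - {k}) a)"
    unfolding sqfree_coeff_add sqfree_coeff_linear_form_mult[OF I insert.prems] insert.IH[OF insert.prems]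
    by (simp add: sub)
  also have "\<dots> = perm_on (insert j J) K a"
    by (rule perm_on_insert_row[symmetric, OF insert.hyps(1) finK insert.hyps(2)])
  finally show ?case .
qed

section \<open>Expansion of the permanent about the column means\<close>

text \<open>
  An injection on \<open>K\<close> extends to the new column by any row that it leaves free.
\<close>

lemma perm_on_insert_constant_column:
  fixes a :: "'j \<Rightarrow> 'k \<Rightarrow> complex"
  assumes fin: "finite J" "finite K" and k: "k \<notin> K" and w: "\<And>j. j \<in> J \<Longrightarrow> a j k = w"
  shows "perm_on J (insert k K) a = of_nat (card J - card K) * w * perm_on J K a"
proof -
  have "perm_on J (insert k K) a =
     (\<Sum>(f, j)\<in>(SIGMA f:inj_maps K J. J - f ` K). w * (\<Prod>i\<in>K. a (f i) i))"
    unfolding perm_on_def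
  proof (rule sum.reindex_bij_witness[where
        i = "\<lambda>(f, j). f(k := j)" and j = "\<lambda>f. (f(k := undefined), f k)"], goal_cases)
    case (1 f)
    then show ?case by auto
  next
    case (2 f)
    then have f: "f \<in> insert k K \<rightarrow>\<^sub>E J" "inj_on f (insert k K)" by (auto simp: inj_maps_def)
    have "inj_on (f(k := undefined)) K" using f(2) k by (auto simp: inj_on_def)
    then have "f(k := undefined) \<in> inj_maps K J"
      using f(1) k by (auto simp: inj_maps_def PiE_def Pi_def extensional_def)
    moreover have "f k \<notin> (f(k := undefined)) ` K" using f(2) k by (auto simp: inj_on_def)
    ultimately show ?case using f(1) by auto
  next
    case (3 b)
    then show ?case using k by (auto simp: inj_maps_def PiE_def extensional_def)
  next
    case (4 b)
    then obtain f j where b: "b = (f, j)" "f \<in> K \<rightarrow>\<^sub>E J" "inj_on f K" "j \<in> J" "j \<notin> f ` K"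
      by (auto simp: inj_maps_def)
    have "inj_on (f(k := j)) (insert k K)" using b(3,5) k by (auto simp: inj_on_def)
    then show ?case using b k by (auto simp: inj_maps_def PiE_def Pi_def extensional_def)
  next
    case (5 f)
    have "(\<Prod>i\<in>K. a ((f(k := undefined)) i) i) = (\<Prod>i\<in>K. a (f i) i)"
      using k by (intro prod.cong) auto
    moreover have "a (f k) k = w" using 5 by (intro w) (auto simp: inj_maps_def)
    ultimately show ?case using fin k by simp
  qed
  also have "\<dots> = (\<Sum>f\<in>inj_maps K J. \<Sum>j\<in>J - f ` K. w * (\<Prod>i\<in>K. a (f i) i))"
    using fin by (subst sum.Sigma) auto
  also have "\<dots> = (\<Sum>f\<in>inj_maps K J. of_nat (card J - card K) * w * (\<Prod>i\<in>K. a (f i) i))"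
  proof (intro sum.cong refl)
    fix f assume "f \<in> inj_maps K J"
    then have "f ` K \<subseteq> J" "card (f ` K) = card K" by (auto simp: inj_maps_def card_image)
    then have "card (J - f ` K) = card J - card K" using fin by (simp add: card_Diff_subset)
    then show "(\<Sum>j\<in>J - f ` K. w * (\<Prod>i\<in>K. a (f i) i)) = of_nat (card J - card K) * w * (\<Prod>i\<in>K. a (f i) i)"
      by simp
  qed
  finally show ?thesis by (simp add: perm_on_def sum_distrib_left)
qed

text \<open>
  Written with factorials on both sides, so that the falling factorial which counts the extensions of
  an injection needs no name.
\<close>

lemma perm_on_constant_columns:
  fixes a :: "'j \<Rightarrow> 'k \<Rightarrow> complex"
  assumes fin: "finite J" "finite K" "finite L" and disj: "K \<inter> L = {}" and le: "card K + card L \<le> card J"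
    and w: "\<And>j k. j \<in> J \<Longrightarrow> k \<in> L \<Longrightarrow> a j k = w k"
  shows "fact (card J - card K - card L) * perm_on J (K \<union> L) a =
    fact (card J - card K) * ((\<Prod>k\<in>L. w k) * perm_on J K a)"
  using fin(3) disj le w
proof (induction L rule: finite_induct)
  case (insert l L)
  let ?r = "card J - card K - card L"
  have cardU: "card (K \<union> L) = card K + card L"
    using fin(2) insert by (intro card_Un_disjoint) auto
  have r: "?r > 0" using insert by simp
  have "perm_on J (insert l (K \<union> L)) a = of_nat (card J - card (K \<union> L)) * w l * perm_on J (K \<union> L) a"
    using fin insert cardU by (intro perm_on_insert_constant_column) auto
  then have "fact (?r - 1) * perm_on J (K \<union> insert l L) a = w l * (of_nat ?r * fact (?r - 1) * perm_on J (K \<union> L) a)"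
    by (simp add: cardU mult_ac)
  also have "of_nat ?r * fact (?r - 1) = (fact ?r :: complex)"
    by (rule fact_reduce[symmetric, OF r])
  also have "fact ?r * perm_on J (K \<union> L) a = fact (card J - card K) * ((\<Prod>k\<in>L. w k) * perm_on J K a)"
    using insert by (intro insert.IH) auto
  finally show ?case using insert.hyps by (simp add: mult_ac)
qed simp

text \<open>
  Expansion of the permanent when the mean \<open>w k\<close> is split off from every column: the set \<open>K\<close> collects
  the columns in which the deviation from the mean is chosen, and the others are constant.
\<close>

lemma perm_on_add_constant:
  fixes a :: "'j \<Rightarrow> 'k \<Rightarrow> complex"
  assumes fin: "finite J" "finite I" and le: "card I \<le> card J"
  shows "fact (card J - card I) * perm_on J I (\<lambda>j k. a j k + w k) =
    (\<Sum>K\<in>Pow I. fact (card J - card K) * ((\<Prod>k\<in>I - K. w k) * perm_on J K a))"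
proof -
  have "perm_on J I (\<lambda>j k. a j k + w k) =
      (\<Sum>f\<in>inj_maps I J. \<Sum>K\<in>Pow I. \<Prod>k\<in>I. if k \<in> I - K then w k else a (f k) k)"
    unfolding perm_on_def prod_add[OF fin(2)]
  proof (intro sum.cong refl)
    fix f K assume "K \<in> Pow I"
    then show "(\<Prod>k\<in>K. a (f k) k) * (\<Prod>k\<in>I - K. w k) = (\<Prod>k\<in>I. if k \<in> I - K then w k else a (f k) k)"
      using fin(2) by (subst prod.subset_diff[of K I]) (auto intro!: arg_cong2[of _ _ _ _ "(*)"] prod.cong simp: mult.commute)
  qed
  also have "\<dots> = (\<Sum>K\<in>Pow I. perm_on J I (\<lambda>j k. if k \<in> I - K then w k else a j k))"
    unfolding perm_on_def by (rule sum.swap)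
  finally have "fact (card J - card I) * perm_on J I (\<lambda>j k. a j k + w k) =
      (\<Sum>K\<in>Pow I. fact (card J - card I) * perm_on J I (\<lambda>j k. if k \<in> I - K then w k else a j k))"
    by (simp add: sum_distrib_left)
  also have "\<dots> = (\<Sum>K\<in>Pow I. fact (card J - card K) * ((\<Prod>k\<in>I - K. w k) * perm_on J K a))"
  proof (intro sum.cong refl)
    fix K assume "K \<in> Pow I"
    then have K: "K \<subseteq> I" "finite K" using fin finite_subset by auto
    have card: "card K + card (I - K) = card I" "card K \<le> card I"
      using K fin by (simp_all add: card_Diff_subset card_mono)
    let ?b = "\<lambda>j k. if k \<in> I - K then w k else a j k"
    have "fact (card J - card K - card (I - K)) * perm_on J (K \<union> (I - K)) ?b =
       fact (card J - card K) * ((\<Prod>k\<in>I - K. w k) * perm_on J K ?b)"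
      using fin K card le by (intro perm_on_constant_columns) auto
    moreover have "perm_on J K ?b = perm_on J K a" using K by (intro perm_on_cong) auto
    moreover have "K \<union> (I - K) = I" "card J - card K - card (I - K) = card J - card I"
      using K card by auto
    ultimately show "fact (card J - card I) * perm_on J I ?b =
        fact (card J - card K) * ((\<Prod>k\<in>I - K. w k) * perm_on J K a)" by simp
  qed
  finally show ?thesis .
qed

text \<open>
  Each factor \<open>1 + U\<^sub>j\<close> supplies at most one indeterminate, so the product contributes a permanent
  over the rows for each set \<open>K\<close> of columns, and the power selects the sets with \<open>m\<close> elements.
\<close>

lemma G_eq_sum_perm:
  assumes "m \<le> n"
  shows "G N n m Z = fact (N - m) / fact N *
    (\<Sum>K | K \<subseteq> {1..n} \<and> card K = m. perm_on {1..N} K (centred N Z) * (\<Prod>k\<in>{1..n} - K. col_mean N Z k))"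
proof -
  let ?I = "{1..n}" and ?J = "{1..N}"
  have "coeff_x1_xn n ((\<Prod>j=1..N. 1 + U N n Z j) * (\<Sum>k=1..n. const_poly (col_mean N Z k) * indet k) ^ (n - m)) =
     sqfree_coeff ?I ((\<Prod>j\<in>?J. 1 + linear_form ?I (centred N Z j)) * linear_form ?I (col_mean N Z) ^ (n - m))"
    by (simp add: coeff_x1_xn_def sqfree_coeff_def sqfree_monom_def U_def linear_form_def)
  also have "\<dots> = (\<Sum>K\<in>Pow ?I. perm_on ?J K (centred N Z) *
       (if card (?I - K) = n - m then fact (n - m) * (\<Prod>k\<in>?I - K. col_mean N Z k) else 0))"
    by (subst sqfree_coeff_mult)
       (auto intro!: sum.cong simp: sqfree_coeff_prod_linear_forms sqfree_coeff_linear_form_power)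
  also have "\<dots> = (\<Sum>K\<in>Pow ?I. if card K = m then fact (n - m) *
        (perm_on ?J K (centred N Z) * (\<Prod>k\<in>?I - K. col_mean N Z k)) else 0)"
  proof (intro sum.cong refl)
    fix K assume "K \<in> Pow ?I"
    then have K: "K \<subseteq> ?I" "finite K" using finite_subset by auto
    then have "card (?I - K) = n - card K" "card K \<le> n" using card_mono[of ?I K] by (auto simp: card_Diff_subset)
    then have "card (?I - K) = n - m \<longleftrightarrow> card K = m" using assms by auto
    then show "perm_on ?J K (centred N Z) *
       (if card (?I - K) = n - m then fact (n - m) * (\<Prod>k\<in>?I - K. col_mean N Z k) else 0) =
       (if card K = m then fact (n - m) *
        (perm_on ?J K (centred N Z) * (\<Prod>k\<in>?I - K. col_mean N Z k)) else 0)" by simp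
  qed
  also have "\<dots> = fact (n - m) * (\<Sum>K | K \<subseteq> ?I \<and> card K = m.
       perm_on ?J K (centred N Z) * (\<Prod>k\<in>?I - K. col_mean N Z k))"
    by (simp add: sum.inter_filter[symmetric] sum_distrib_left)
  finally show ?thesis by (simp add: G_def)
qed

text \<open>
  The \<open>G\<^sub>m\<close> are the parts of the normalised permanent of degree \<open>m\<close> in the deviations from the
  column means. The sum over all degrees is exact, so the error of the truncation is a tail.
\<close>

lemma Per_eq_sum_G:
  assumes "n \<le> N"
  shows "fact (N - n) / fact N * Per N n Z = (\<Sum>m\<le>n. G N n m Z)"
proof -
  let ?I = "{1..n}" and ?J = "{1..N}"
  define t where "t = (\<lambda>K. perm_on ?J K (centred N Z) * (\<Prod>k\<in>?I - K. col_mean N Z k))"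
  have "Per N n Z = perm_on ?J ?I (\<lambda>j k. centred N Z j k + col_mean N Z k)"
    by (simp add: Per_def perm_on_def inj_maps_def centred_def)
  then have "fact (N - n) * Per N n Z = (\<Sum>K\<in>Pow ?I. fact (N - card K) * t K)"
    using perm_on_add_constant[of ?J ?I "centred N Z" "col_mean N Z"] assms by (simp add: t_def mult_ac)
  also have "\<dots> = (\<Sum>m\<le>n. \<Sum>K\<in>{K \<in> Pow ?I. card K = m}. fact (N - card K) * t K)"
    by (intro sum.group[symmetric]) (auto dest: card_mono[rotated])
  also have "\<dots> = (\<Sum>m\<le>n. fact N * G N n m Z)"
    by (intro sum.cong refl) (auto simp: G_eq_sum_perm t_def sum_distrib_left intro!: sum.cong)
  finally show ?thesis by (simp add: sum_distrib_left[symmetric] field_simps)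
qed

section \<open>Stirling type estimates\<close>

text \<open>
  The sequence \<open>p\<^sup>p / (e\<^sup>p p!)\<close> decreases, because \<open>(1 + 1 / p)\<^sup>p \<le> e\<close>.
\<close>

lemma self_power_over_fact_le:
  "real (k + m) ^ (k + m) * fact k \<le> exp (real m) * fact (k + m) * real k ^ k"
proof (induction m)
  case (Suc m)
  let ?p = "k + m"
  have step: "real (Suc p) ^ p \<le> exp 1 * real p ^ p" for p
  proof (cases "p = 0")
    case False
    have "real (Suc p) = real p * (1 + 1 / real p)" using False by (simp add: field_simps)
    then have "real (Suc p) ^ p = (real p * (1 + 1 / real p)) ^ p" by simp
    also have "\<dots> = (1 + 1 / real p) ^ p * real p ^ p" by (simp add: power_mult_distrib)
    also have "\<dots> \<le> exp 1 * real p ^ p"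
      using False by (intro mult_right_mono exp_ge_one_plus_x_over_n_power_n) auto
    finally show ?thesis .
  qed simp
  have "real (k + Suc m) ^ (k + Suc m) * fact k = real (Suc ?p) * (real (Suc ?p) ^ ?p * fact k)"
    by simp
  also have "\<dots> \<le> real (Suc ?p) * (exp 1 * real ?p ^ ?p * fact k)"
    by (intro mult_left_mono mult_right_mono step) auto
  also have "\<dots> = real (Suc ?p) * exp 1 * (real ?p ^ ?p * fact k)" by simp
  also have "\<dots> \<le> real (Suc ?p) * exp 1 * (exp (real m) * fact ?p * real k ^ k)"
    by (intro mult_left_mono Suc.IH) auto
  also have "\<dots> = exp (real (Suc m)) * fact (k + Suc m) * real k ^ k"
    by (simp add: exp_add mult_ac)
  finally show ?case .
qed simp

text \<open>
  Both sides are products of factors \<open>1 - i / n\<close> and \<open>1 - i / N\<close> with \<open>i < m\<close>.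
\<close>

lemma falling_factorial_ratio_mono:
  assumes "m \<le> n" "n \<le> N"
  shows "fact n / (fact (n - m) * real n ^ m) \<le> fact N / (fact (N - m) * real N ^ m)"
  using assms(1)
proof (induction m)
  case (Suc m)
  have step: "fact q / (fact (q - Suc m) * real q ^ Suc m) =
      fact q / (fact (q - m) * real q ^ m) * (1 - real m / real q)" if "m < q" for q
  proof -
    have "fact (q - m) = (real q - real m) * fact (q - Suc m)"
      using that fact_reduce[of "q - m", where 'a = real] by (simp add: of_nat_diff)
    moreover have "1 - real m / real q = (real q - real m) / real q"
      using that by (simp add: diff_divide_distrib)
    ultimately show ?thesis using that by simp
  qed
  have "real m / real N \<le> real m / real n" using assms Suc.prems by (intro divide_left_mono) auto
  then have "fact n / (fact (n - m) * real n ^ m) * (1 - real m / real n) \<le>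
      fact N / (fact (N - m) * real N ^ m) * (1 - real m / real N)"
    using Suc assms by (intro mult_mono) auto
  then show ?case using step[of n] step[of N] Suc.prems assms by simp
qed simp

text \<open>
  Collects the constants from \<open>perm_centred_bound\<close> and \<open>maclaurin_esym_le\<close>. That the columns
  are no more numerous than the rows enters here through \<open>falling_factorial_ratio_mono\<close>, which
  reduces the claim to \<open>n = N\<close>; what then remains is \<open>self_power_over_fact_le\<close>.
\<close>

lemma permanent_constants_le:
  assumes "1 \<le> n" "m \<le> n" "n \<le> N"
  shows "(fact (N - m) / fact N)\<^sup>2 * (fact m)\<^sup>2 * (real N ^ (N - m) / real (N - m) ^ (N - m)) *
      real (n choose m) * real N ^ m \<le> exp (real m) * fact m * real n ^ m / real N ^ m"
proof -
  let ?q = "real (N - m) ^ (N - m)"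
  define f :: real where "f = fact (N - m) / fact N"
  have f0: "f > 0" by (simp add: f_def)
  have "real p ^ p > 0" for p :: nat by (cases "p = 0") auto
  then have q0: "?q > 0" .
  have N0: "real N ^ m > 0" "real n ^ m > 0" using assms by auto
  have "real (n choose m) * fact m = fact n / fact (n - m)"
    using binomial_fact[OF assms(2), where 'a = real] by simp
  also have "\<dots> = real n ^ m * (fact n / (fact (n - m) * real n ^ m))" using N0 by simp
  also have "\<dots> \<le> real n ^ m * (fact N / (fact (N - m) * real N ^ m))"
    by (intro mult_left_mono falling_factorial_ratio_mono assms) simp
  also have "\<dots> = real n ^ m / (f * real N ^ m)" by (simp add: f_def)
  finally have 1: "real (n choose m) * fact m \<le> real n ^ m / (f * real N ^ m)" .
  have "real N ^ N * fact (N - m) \<le> exp (real m) * fact N * ?q"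
    using self_power_over_fact_le[of "N - m" m] assms by simp
  then have 2: "f * (real N ^ N / ?q) \<le> exp (real m)"
    using q0 by (simp add: f_def divide_simps) (simp add: mult_ac)
  have NN: "real N ^ (N - m) * real N ^ m = real N ^ N"
    using assms by (simp add: power_add[symmetric])
  have "f\<^sup>2 * (fact m)\<^sup>2 * (real N ^ (N - m) / ?q) * real (n choose m) * real N ^ m =
      f\<^sup>2 * fact m * (real N ^ N / ?q) * (real (n choose m) * fact m)"
    unfolding NN[symmetric] by (simp add: power2_eq_square mult_ac)
  also have "\<dots> \<le> f\<^sup>2 * fact m * (real N ^ N / ?q) * (real n ^ m / (f * real N ^ m))"
    using q0 by (intro mult_left_mono 1) auto
  also have "\<dots> = (f * (real N ^ N / ?q)) * (fact m * real n ^ m / real N ^ m)"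
    using f0 by (simp add: power2_eq_square)
  also have "\<dots> \<le> exp (real m) * (fact m * real n ^ m / real N ^ m)"
    by (intro mult_right_mono 2) auto
  finally show ?thesis by (simp add: f_def mult_ac)
qed

lemma ln_one_plus_ge:
  fixes x :: real
  assumes "x \<ge> 0"
  shows "2 * x / (2 + x) \<le> ln (1 + x)"
proof -
  let ?f = "\<lambda>x::real. ln (1 + x) - 2 * x / (2 + x)"
  have "?f 0 \<le> ?f x"
  proof (rule DERIV_nonneg_imp_nondecreasing[OF assms])
    fix t :: real assume t: "0 \<le> t" "t \<le> x"
    have "DERIV ?f t :> 1 / (1 + t) - (2 * (2 + t) - 2 * t) / ((2 + t) * (2 + t))"
      using t by (auto intro!: derivative_eq_intros simp: field_simps)
    moreover have "1 / (1 + t) - (2 * (2 + t) - 2 * t) / ((2 + t) * (2 + t)) = t\<^sup>2 / ((1 + t) * (2 + t)\<^sup>2)"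
      using t by (simp add: divide_simps) (simp add: power2_eq_square algebra_simps)
    moreover have "t\<^sup>2 / ((1 + t) * (2 + t)\<^sup>2) \<ge> 0" using t by simp
    ultimately show "\<exists>y. DERIV ?f t :> y \<and> y \<ge> 0" by metis
  qed
  then show ?thesis by simp
qed

text \<open>
  In logarithms and with \<open>x = 1 / r\<close> this is the inequality
  \<open>x \<le> ln (1 + x) + x ln (1 + x / 2)\<close>, and the bounds \<open>2 x / (2 + x)\<close> and \<open>x / (2 + x)\<close>
  for the two logarithms combine to exactly \<open>x\<close>.
\<close>

lemma exp_1_le_power_mult:
  assumes "r \<ge> 1"
  shows "exp 1 \<le> (1 + 1 / real r) ^ r * (1 + 1 / (2 * real r))"
proof -
  define x where "x = 1 / real r"
  have x: "x > 0" "real r * x = 1" using assms by (auto simp: x_def)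
  have "1 = real r * (2 * x / (2 + x)) + x / (2 + x)"
  proof -
    have "real r * (2 * x / (2 + x)) = 2 * (real r * x) / (2 + x)" by simp
    also have "\<dots> = 2 / (2 + x)" by (simp only: x)
    finally have "real r * (2 * x / (2 + x)) + x / (2 + x) = (2 + x) / (2 + x)"
      by (simp only: add_divide_distrib)
    then show ?thesis using x by simp
  qed
  also have "\<dots> \<le> real r * ln (1 + x) + ln (1 + x / 2)"
  proof (intro add_mono mult_left_mono ln_one_plus_ge)
    have "ln (1 / (1 + x / 2)) \<le> 1 / (1 + x / 2) - 1" using x by (intro ln_le_minus_one) simp
    then show "x / (2 + x) \<le> ln (1 + x / 2)" using x by (simp add: ln_div field_simps)
  qed (use x in auto)
  also have "\<dots> = ln ((1 + x) ^ r * (1 + x / 2))"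
    using x by (simp add: ln_mult ln_realpow)
  finally have "exp 1 \<le> exp (ln ((1 + x) ^ r * (1 + x / 2)))" by simp
  also have "\<dots> = (1 + x) ^ r * (1 + x / 2)" using x by (intro exp_ln mult_pos_pos zero_less_power) auto
  finally show ?thesis by (simp add: x_def mult.commute[of _ 2])
qed

text \<open>
  The square of \<open>r\<^bsup>1/4\<^esup> C\<^sub>r\<close>; by Stirling's formula this ratio is asymptotic to the square root of \<open>2 \<pi> r\<close>.
\<close>

definition stirling_ratio :: "nat \<Rightarrow> real" where
  "stirling_ratio r = exp (real r) * fact r / real r ^ r"

lemma stirling_ratio_pos: "r \<ge> 1 \<Longrightarrow> stirling_ratio r > 0"
  by (simp add: stirling_ratio_def)

lemma stirling_ratio_Suc:
  assumes "r \<ge> 1"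
  shows "stirling_ratio (Suc r) \<le> stirling_ratio r * (1 + 1 / (2 * real r))"
proof -
  have pos: "(1 + 1 / real r) ^ r > 0" by (intro zero_less_power add_pos_nonneg) auto
  have pw: "real (Suc r) ^ r = real r ^ r * (1 + 1 / real r) ^ r"
  proof -
    have "real (Suc r) = real r * (1 + 1 / real r)" using assms by (simp add: field_simps)
    then show ?thesis by (simp only: power_mult_distrib)
  qed
  have "stirling_ratio (Suc r) = exp (real r) * exp 1 * fact r / real (Suc r) ^ r"
    by (simp add: stirling_ratio_def exp_add mult_ac del: of_nat_Suc) (simp add: exp_add mult_ac)
  also have "\<dots> = stirling_ratio r * (exp 1 / (1 + 1 / real r) ^ r)"
    unfolding pw stirling_ratio_def by simp
  also have "\<dots> \<le> stirling_ratio r * (1 + 1 / (2 * real r))"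
    using exp_1_le_power_mult[OF assms] pos stirling_ratio_pos[OF assms]
    by (intro mult_left_mono) (auto simp: pos_divide_le_eq mult.commute)
  finally show ?thesis .
qed

text \<open>
  The right-hand factors are the coefficients of \<open>(1 - g)\<^bsup>-3/2\<^esup>\<close>. Their quotients
  are \<open>1 + 1 / (2 (k + 1))\<close>, while those of the left-hand side are at most \<open>1 + 1 / (2 (r + k))\<close>.
\<close>

lemma stirling_ratio_add_le:
  assumes "r \<ge> 1"
  shows "stirling_ratio (r + k) \<le> stirling_ratio r * (pochhammer (3/2) k / fact k)"
proof (induction k)
  case (Suc k)
  have "stirling_ratio (r + Suc k) \<le> stirling_ratio (r + k) * (1 + 1 / (2 * real (r + k)))"
    using stirling_ratio_Suc[of "r + k"] assms by simp
  also have "\<dots> \<le> stirling_ratio (r + k) * (1 + 1 / (2 * real (Suc k)))"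
    using assms stirling_ratio_pos[of "r + k"]
    by (intro mult_left_mono add_left_mono divide_left_mono) auto
  also have "\<dots> \<le> stirling_ratio r * (pochhammer (3/2) k / fact k) * (1 + 1 / (2 * real (Suc k)))"
    by (intro mult_right_mono Suc.IH) auto
  also have "\<dots> = stirling_ratio r * (pochhammer (3/2) (Suc k) / fact (Suc k))"
  proof -
    have "pochhammer (3/2) (Suc k) / fact (Suc k) = pochhammer (3/2) k / fact k * ((3/2 + real k) / real (Suc k))"
      by (simp add: pochhammer_Suc)
    moreover have "(3/2 + real k) / real (Suc k) = 1 + 1 / (2 * real (Suc k))" by (simp add: field_simps)
    ultimately show ?thesis by (simp only: mult.assoc)
  qed
  finally show ?case .
qed simp

lemma sum_stirling_ratio_powers_le:
  assumes r: "r \<ge> 1" and g: "0 \<le> g" "g < 1"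
  shows "(\<Sum>m=r..n. stirling_ratio m * g ^ m) \<le> stirling_ratio r * g ^ r * (1 - g) powr (- (3/2))"
proof -
  define c where "c = (\<lambda>k. pochhammer (3/2) k / fact k :: real)"
  have c0: "c k \<ge> 0" for k unfolding c_def by (intro divide_nonneg_pos pochhammer_nonneg) auto
  have "(\<lambda>k. ((- (3/2)) gchoose k) * (- g) ^ k) sums (1 + (- g)) powr (- (3/2))"
    using g by (intro gen_binomial_real) auto
  moreover have "((- (3/2)) gchoose k) * (- g) ^ k = c k * g ^ k" for k
  proof -
    have "(- g) ^ k = (-1) ^ k * g ^ k" by (rule power_minus)
    moreover have "(-1) ^ k * (-1) ^ k = (1::real)" by (simp flip: power_mult_distrib)
    ultimately show ?thesis unfolding gbinomial_pochhammer by (simp add: c_def)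
  qed
  ultimately have sums: "(\<lambda>k. c k * g ^ k) sums (1 - g) powr (- (3/2))" by simp
  have "(\<Sum>m=r..n. stirling_ratio m * g ^ m) \<le> (\<Sum>m=r..n. stirling_ratio r * g ^ r * (c (m - r) * g ^ (m - r)))"
  proof (rule sum_mono)
    fix m assume m: "m \<in> {r..n}"
    then have "stirling_ratio m * g ^ m \<le> (stirling_ratio r * c (m - r)) * g ^ m"
      using stirling_ratio_add_le[OF r, of "m - r"] g by (intro mult_right_mono) (auto simp: c_def)
    also have "(stirling_ratio r * c (m - r)) * g ^ m = (stirling_ratio r * c (m - r)) * (g ^ r * g ^ (m - r))"
      using m by (simp flip: power_add)
    finally show "stirling_ratio m * g ^ m \<le> stirling_ratio r * g ^ r * (c (m - r) * g ^ (m - r))"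
      by (simp add: mult_ac)
  qed
  also have "\<dots> = stirling_ratio r * g ^ r * (\<Sum>m=r..n. c (m - r) * g ^ (m - r))"
    by (rule sum_distrib_left[symmetric])
  also have "(\<Sum>m=r..n. c (m - r) * g ^ (m - r)) = (\<Sum>k\<in>(\<lambda>m. m - r) ` {r..n}. c k * g ^ k)"
    by (subst sum.reindex) (auto simp: inj_on_def)
  also have "\<dots> \<le> (1 - g) powr (- (3/2))"
    using sum_le_suminf[OF sums_summable[OF sums], of "(\<lambda>m. m - r) ` {r..n}"] c0 g
    by (simp add: sums_unique[OF sums, symmetric])
  finally show ?thesis using g stirling_ratio_pos[OF r] by (simp add: mult_left_mono)
qed

text \<open>
  For \<open>\<mu> = 1 / (1 - b)\<close> these are binomial probabilities. For \<open>\<mu> = n\<close> they are dominated by the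
  terms of \<open>(1 + 1 / n)\<^sup>n \<le> e \<le> 3\<close>, of which the two terms with \<open>m = 0\<close> and \<open>m = 1\<close>,
  each equal to \<open>1\<close>, are absent because \<open>r \<ge> 2\<close>.
\<close>

lemma binomial_tail_weights_le_1:
  fixes b \<mu> :: real
  assumes b: "0 \<le> b" "b \<le> 1" and \<mu>: "\<mu> = real n \<or> (b \<noteq> 1 \<and> \<mu> = 1 / (1 - b))"
    and n: "1 \<le> n" and r: "2 \<le> r"
  shows "(\<Sum>m=r..n. real (n choose m) * b ^ (n - m) / \<mu> ^ m) \<le> 1"
proof -
  have "\<mu> > 0" using \<mu> n b by auto
  show ?thesis
    using \<mu>
  proof
    assume \<mu>: "\<mu> = real n"
    have "(\<Sum>m=r..n. real (n choose m) * b ^ (n - m) / \<mu> ^ m) \<le> (\<Sum>m=r..n. real (n choose m) * (1 / real n) ^ m)"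
      unfolding \<mu> using b by (intro sum_mono) (simp add: power_divide divide_right_mono mult_left_le power_le_one)
    also have "\<dots> = (\<Sum>m\<in>{r..n} \<union> {0, 1}. real (n choose m) * (1 / real n) ^ m) - 2"
      using n r by (subst sum.union_disjoint) auto
    also have "(\<Sum>m\<in>{r..n} \<union> {0, 1}. real (n choose m) * (1 / real n) ^ m)
        \<le> (\<Sum>m\<le>n. real (n choose m) * (1 / real n) ^ m)"
      using n by (intro sum_mono2) auto
    also have "\<dots> = (1 / real n + 1) ^ n"
      unfolding binomial_ring by simp
    also have "\<dots> \<le> exp 1"
      using exp_ge_one_plus_x_over_n_power_n[of n 1] n by (simp add: add.commute)
    also have "\<dots> \<le> 3" by (rule exp_le)
    finally show ?thesis by simp
  next
    assume \<mu>: "b \<noteq> 1 \<and> \<mu> = 1 / (1 - b)"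
    have "(\<Sum>m=r..n. real (n choose m) * b ^ (n - m) / \<mu> ^ m) \<le> (\<Sum>m\<le>n. real (n choose m) * b ^ (n - m) / \<mu> ^ m)"
      using b \<open>\<mu> > 0\<close> by (intro sum_mono2) auto
    also have "\<dots> = (\<Sum>m\<le>n. real (n choose m) * (1 - b) ^ m * b ^ (n - m))"
      using \<mu> by (intro sum.cong) (auto simp: power_divide)
    also have "\<dots> = ((1 - b) + b) ^ n" by (rule binomial_ring[symmetric])
    finally show ?thesis by simp
  qed
qed

section \<open>The approximation error\<close>

text \<open>
  The Cauchy--Schwarz inequality over the sets \<open>K\<close> of \<open>m\<close> columns separates the permanents of the deviations from the
  products of means. Each of the two sums is an elementary symmetric polynomial in column norms or in
  squared means, and Maclaurin's inequality turns these into \<open>\<alpha>\<close> and \<open>\<beta>\<close>. Only one of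
  the two binomial coefficients is absorbed by the constants; the other is kept as
  a weight over which the sum over \<open>m\<close> will converge.
\<close>

lemma G_cmod_square_le:
  fixes Z :: "nat \<Rightarrow> nat \<Rightarrow> complex"
  assumes m: "0 < m" "m \<le> n" and n: "n \<le> N"
  shows "(cmod (G N n m Z))\<^sup>2 \<le>
    (real (n choose m) * \<beta> N n Z ^ (n - m)) * (stirling_ratio m * (real n * \<alpha> N n Z / real N) ^ m)"
proof -
  let ?I = "{1..n}" and ?J = "{1..N}"
  let ?S = "{K. K \<subseteq> ?I \<and> card K = m}"
  define a where "a = centred N Z"
  define w where "w = col_mean N Z"
  define f :: real where "f = fact (N - m) / fact N"
  define B where "B = (fact m)\<^sup>2 * (real N ^ (N - m) / (real (N - m) ^ (N - m) * real m ^ m))"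
  have N: "N > 0" "m \<le> N" "n > 0" using m n by auto
  have B0: "B \<ge> 0" by (simp add: B_def)
  have \<alpha>0: "\<alpha> N n Z \<ge> 0" by (simp add: \<alpha>_def sum_nonneg)
  have \<beta>0: "\<beta> N n Z \<ge> 0" by (simp add: \<beta>_def sum_nonneg)
  have sum0: "(\<Sum>j\<in>?J. a j k) = 0" for k
    using N by (simp add: a_def centred_def col_mean_def sum_subtractf)
  have P: "(\<Sum>K\<in>?S. (cmod (perm_on ?J K a))\<^sup>2) \<le> B * (real (n choose m) * (real N * \<alpha> N n Z) ^ m)"
  proof -
    have "(\<Sum>K\<in>?S. (cmod (perm_on ?J K a))\<^sup>2) \<le> (\<Sum>K\<in>?S. B * (\<Prod>k\<in>K. \<Sum>j\<in>?J. (cmod (a j k))\<^sup>2))"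
      unfolding B_def using m N finite_subset by (intro sum_mono perm_centred_bound sum0) auto
    also have "\<dots> = B * esym ?I m (\<lambda>k. \<Sum>j\<in>?J. (cmod (a j k))\<^sup>2)"
      by (simp add: esym_def sum_distrib_left)
    also have "\<dots> \<le> B * (real (card ?I choose m) * ((\<Sum>k\<in>?I. \<Sum>j\<in>?J. (cmod (a j k))\<^sup>2) / card ?I) ^ m)"
      using B0 by (intro mult_left_mono maclaurin_esym_le) (auto intro: sum_nonneg)
    also have "(\<Sum>k\<in>?I. \<Sum>j\<in>?J. (cmod (a j k))\<^sup>2) / card ?I = real N * \<alpha> N n Z"
      using N by (subst sum.swap) (simp add: \<alpha>_def a_def field_simps)
    finally show ?thesis by simp
  qed
  have W: "(\<Sum>K\<in>?S. (cmod (\<Prod>k\<in>?I - K. w k))\<^sup>2) \<le> real (n choose m) * \<beta> N n Z ^ (n - m)"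
  proof -
    have "(\<Sum>K\<in>?S. (cmod (\<Prod>k\<in>?I - K. w k))\<^sup>2) = (\<Sum>K\<in>?S. \<Prod>k\<in>?I - K. (cmod (w k))\<^sup>2)"
      by (simp add: prod_norm[symmetric] prod_power_distrib)
    also have "\<dots> = esym ?I (n - m) (\<lambda>k. (cmod (w k))\<^sup>2)"
      unfolding esym_def
    proof (rule sum.reindex_bij_witness[where i = "\<lambda>T. ?I - T" and j = "\<lambda>K. ?I - K"])
      fix K assume "K \<in> ?S"
      then show "?I - K \<in> {T. T \<subseteq> ?I \<and> card T = n - m}" by (auto simp: card_Diff_subset finite_subset)
    next
      fix T assume T: "T \<in> {T. T \<subseteq> ?I \<and> card T = n - m}"
      then have "finite T" using finite_subset by auto
      then show "?I - T \<in> ?S" using T m by (auto simp: card_Diff_subset)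
    qed auto
    also have "\<dots> \<le> real (card ?I choose (n - m)) * ((\<Sum>k\<in>?I. (cmod (w k))\<^sup>2) / card ?I) ^ (n - m)"
      by (intro maclaurin_esym_le) auto
    also have "\<dots> = real (n choose m) * \<beta> N n Z ^ (n - m)"
      using m by (simp add: \<beta>_def w_def binomial_symmetric[of m n])
    finally show ?thesis .
  qed
  have "cmod (G N n m Z) = f * cmod (\<Sum>K\<in>?S. perm_on ?J K a * (\<Prod>k\<in>?I - K. w k))"
    unfolding G_eq_sum_perm[OF m(2)] by (simp add: norm_mult norm_divide f_def a_def w_def)
  also have "\<dots> \<le> f * (\<Sum>K\<in>?S. cmod (perm_on ?J K a) * cmod (\<Prod>k\<in>?I - K. w k))"
    by (intro mult_left_mono sum_norm_le) (auto simp: norm_mult f_def)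
  finally have "(cmod (G N n m Z))\<^sup>2 \<le> (f * (\<Sum>K\<in>?S. cmod (perm_on ?J K a) * cmod (\<Prod>k\<in>?I - K. w k)))\<^sup>2"
    by (intro power_mono) auto
  also have "\<dots> = f\<^sup>2 * (\<Sum>K\<in>?S. cmod (perm_on ?J K a) * cmod (\<Prod>k\<in>?I - K. w k))\<^sup>2"
    by (rule power_mult_distrib)
  also have "\<dots> \<le> f\<^sup>2 * ((\<Sum>K\<in>?S. (cmod (perm_on ?J K a))\<^sup>2) * (\<Sum>K\<in>?S. (cmod (\<Prod>k\<in>?I - K. w k))\<^sup>2))"
    by (intro mult_left_mono Cauchy_Schwarz_ineq_sum) simp
  also have "\<dots> \<le> f\<^sup>2 * ((B * (real (n choose m) * (real N * \<alpha> N n Z) ^ m)) * (real (n choose m) * \<beta> N n Z ^ (n - m)))"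
    using B0 \<alpha>0 by (intro mult_left_mono mult_mono P W) (auto intro!: sum_nonneg)
  also have "\<dots> = (real (n choose m) * \<beta> N n Z ^ (n - m)) * \<alpha> N n Z ^ m *
      (f\<^sup>2 * (fact m)\<^sup>2 * (real N ^ (N - m) / real (N - m) ^ (N - m)) * real (n choose m) * real N ^ m) / real m ^ m"
    by (simp add: B_def power_mult_distrib mult_ac)
  also have "\<dots> \<le> (real (n choose m) * \<beta> N n Z ^ (n - m)) * \<alpha> N n Z ^ m *
      (exp (real m) * fact m * real n ^ m / real N ^ m) / real m ^ m"
    unfolding f_def using \<alpha>0 \<beta>0 m n
    by (intro divide_right_mono mult_left_mono permanent_constants_le) auto
  also have "\<dots> = (real (n choose m) * \<beta> N n Z ^ (n - m)) * (stirling_ratio m * (real n * \<alpha> N n Z / real N) ^ m)"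
    by (simp add: stirling_ratio_def power_mult_distrib power_divide mult_ac)
  finally show ?thesis .
qed

lemma \<beta>_le_1:
  assumes "\<And>j k. j \<in> {1..N} \<Longrightarrow> k \<in> {1..n} \<Longrightarrow> cmod (Z j k) \<le> 1" and "1 \<le> N" "1 \<le> n"
  shows "\<beta> N n Z \<le> 1"
proof -
  have "(cmod (col_mean N Z k))\<^sup>2 \<le> 1" if k: "k \<in> {1..n}" for k
  proof -
    have "cmod (\<Sum>j=1..N. Z j k) \<le> (\<Sum>j=1..N. 1)" using assms(1) k by (intro sum_norm_le) auto
    then have "cmod (col_mean N Z k) \<le> 1"
      using assms(2) by (simp add: col_mean_def norm_divide)
    then show ?thesis by (simp add: power_le_one)
  qed
  then have "(\<Sum>k=1..n. (cmod (col_mean N Z k))\<^sup>2) \<le> (\<Sum>k=1..n. 1)" by (intro sum_mono) auto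
  then show ?thesis using assms(3) by (simp add: \<beta>_def)
qed

lemma C_eq_sqrt_stirling_ratio:
  assumes "1 \<le> r"
  shows "(real r powr (1/4) * C r)\<^sup>2 = stirling_ratio r"
proof -
  have r: "real r > 0" using assms by simp
  have "(real r powr (1/4))\<^sup>2 = real r powr (1/2)" using r by (simp add: power2_eq_square flip: powr_add)
  moreover have "(C r)\<^sup>2 = exp (real r) * fact r / real r powr (real r + 1/2)"
    using r by (simp add: C_def power2_eq_square flip: powr_add)
  moreover have "real r powr (real r + 1/2) = real r ^ r * real r powr (1/2)"
    using r by (simp add: powr_add powr_realpow)
  ultimately show ?thesis using r by (simp add: power_mult_distrib stirling_ratio_def)
qed

theorem theorem2p8:
  fixes N n l :: nat and Z :: "nat \<Rightarrow> nat \<Rightarrow> complex"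
  assumes "1 \<le> N"
    and "n \<in> {1..N}"
    and "l \<in> {1..n}"
    and "\<And>j k. j \<in> {1..N} \<Longrightarrow> k \<in> {1..n} \<Longrightarrow> cmod (Z j k) \<le> 1"
    and "\<gamma> N n Z < 1"
  shows "cmod (fact (N - n) / fact N * Per N n Z - H N n l Z)
    \<le> real (l + 1) powr (1/4) * C (l + 1) *
      (\<gamma> N n Z powr (real (l + 1) / 2) / (1 - \<gamma> N n Z) powr (3/4))"
proof -
  define r where "r = l + 1"
  define b where "b = \<beta> N n Z"
  define t where "t = real n * \<alpha> N n Z / real N"
  define \<mu> where "\<mu> = (if b = 1 then real n else min (real n) (1 / (1 - b)))"
  define g where "g = \<gamma> N n Z"
  have n: "1 \<le> n" "n \<le> N" "2 \<le> r" "1 \<le> r" "l \<le> n" using assms(2,3) by (auto simp: r_def)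
  have b: "0 \<le> b" "b \<le> 1"
    using \<beta>_le_1[OF assms(4) assms(1)] n by (auto simp: b_def) (simp add: \<beta>_def sum_nonneg)
  have \<mu>_cases: "\<mu> = real n \<or> (b \<noteq> 1 \<and> \<mu> = 1 / (1 - b))" by (auto simp: \<mu>_def min_def)
  have \<mu>0: "\<mu> > 0" using \<mu>_cases n b by auto
  have t0: "t \<ge> 0" by (simp add: t_def \<alpha>_def sum_nonneg)
  have g_eq: "g = t * \<mu>" by (simp add: g_def \<gamma>_def t_def \<mu>_def b_def)
  have g: "0 \<le> g" "g < 1" using t0 \<mu>0 assms(5) by (auto simp: g_eq[symmetric] g_def[symmetric]) (simp add: g_eq)
  define p where "p = (\<lambda>m. real (n choose m) * b ^ (n - m) / \<mu> ^ m)"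
  define q where "q = (\<lambda>m. stirling_ratio m * g ^ m)"
  have p0: "p m \<ge> 0" for m using b \<mu>0 by (simp add: p_def)
  have q0: "q m \<ge> 0" for m using g by (simp add: q_def stirling_ratio_def)
  have Gm: "cmod (G N n m Z) \<le> sqrt (p m) * sqrt (q m)" if "m \<in> {r..n}" for m
  proof -
    have "(cmod (G N n m Z))\<^sup>2 \<le> (real (n choose m) * b ^ (n - m)) * (stirling_ratio m * t ^ m)"
      using G_cmod_square_le[of m n N Z] that n by (simp add: b_def t_def)
    also have "\<dots> = p m * q m" using \<mu>0 by (simp add: p_def q_def g_eq power_mult_distrib)
    finally show ?thesis by (simp add: real_le_rsqrt real_sqrt_mult[symmetric])
  qed
  have "fact (N - n) / fact N * Per N n Z - H N n l Z = (\<Sum>m=r..n. G N n m Z)"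
  proof -
    have "{..n} = {0..l} \<union> {r..n}" using n by (auto simp: r_def)
    then have "(\<Sum>m\<le>n. G N n m Z) = (\<Sum>m=0..l. G N n m Z) + (\<Sum>m=r..n. G N n m Z)"
      by (simp add: sum.union_disjoint r_def)
    then show ?thesis using Per_eq_sum_G[OF n(2)] by (simp add: H_def)
  qed
  then have "cmod (fact (N - n) / fact N * Per N n Z - H N n l Z) \<le> (\<Sum>m=r..n. sqrt (p m) * sqrt (q m))"
    using Gm by (simp only:) (rule sum_norm_le)
  then have "(cmod (fact (N - n) / fact N * Per N n Z - H N n l Z))\<^sup>2 \<le> (\<Sum>m=r..n. sqrt (p m) * sqrt (q m))\<^sup>2"
    by (intro power_mono) auto
  also have "\<dots> \<le> (\<Sum>m=r..n. (sqrt (p m))\<^sup>2) * (\<Sum>m=r..n. (sqrt (q m))\<^sup>2)"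
    by (rule Cauchy_Schwarz_ineq_sum)
  also have "\<dots> = (\<Sum>m=r..n. p m) * (\<Sum>m=r..n. q m)" by (simp add: p0 q0)
  also have "\<dots> \<le> 1 * (\<Sum>m=r..n. q m)"
    unfolding p_def using binomial_tail_weights_le_1[OF b \<mu>_cases n(1,3)] q0
    by (intro mult_right_mono sum_nonneg) auto
  also have "\<dots> \<le> stirling_ratio r * g ^ r * (1 - g) powr (- (3/2))"
    unfolding q_def using sum_stirling_ratio_powers_le[OF n(4) g] by simp
  also have "\<dots> = (real r powr (1/4) * C r * (g powr (real r / 2) / (1 - g) powr (3/4)))\<^sup>2"
  proof -
    have "(g powr (real r / 2))\<^sup>2 = g ^ r"
      using g n(3) by (cases "g = 0") (simp_all add: power2_eq_square powr_realpow flip: powr_add)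
    moreover have "((1 - g) powr (3/4))\<^sup>2 = (1 - g) powr (3/2)"
      by (simp only: power2_eq_square powr_add[symmetric]) simp
    ultimately have "(real r powr (1/4) * C r * (g powr (real r / 2) / (1 - g) powr (3/4)))\<^sup>2 =
        stirling_ratio r * (g ^ r / (1 - g) powr (3/2))"
      by (simp only: power_mult_distrib[of "real r powr (1/4) * C r"]
          C_eq_sqrt_stirling_ratio[OF n(4)] power_divide)
    then show ?thesis by (simp add: powr_minus_divide)
  qed
  finally have "(cmod (fact (N - n) / fact N * Per N n Z - H N n l Z))\<^sup>2 \<le>
      (real r powr (1/4) * C r * (g powr (real r / 2) / (1 - g) powr (3/4)))\<^sup>2" .
  then have "cmod (fact (N - n) / fact N * Per N n Z - H N n l Z) \<le>
      real r powr (1/4) * C r * (g powr (real r / 2) / (1 - g) powr (3/4))"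
    by (rule power2_le_imp_le) (simp add: C_def)
  then show ?thesis by (simp only: r_def g_def)
qed

end
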